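(* Let $\mathcal{A}$ be a category of algebras, $\mathcal{K}$ a factor congruences presheaf over $\mathcal{A}$, and $A\in\mathcal{A}$. Then the following conditions are equivalent: 1. $A$ is $CBS_{\mathcal{K}}$-complete. 2. $A$ has the $CBS_{\mathcal{K}}$-property.
   Context: A category of algebras $\mathcal{A}$ has as objects algebras of one fixed type $\tau$ and as morphisms all $\tau$-homomorphisms between its objects; $\cong$ means $\tau$-isomorphic. $Con(A)$ is the congruence lattice of $A$, with least element $\Delta_A$ and greatest element $\nabla_A=A^2$; $\lor$ denotes join in $Con(A)$; intervals are taken in $Con(A)$. For $\sigma\subseteq\theta$ in $Con(A)$ put $\theta/\sigma=\{(x_\sigma,y_\sigma)\in (A/\sigma)^2:(x,y)\in\theta\}\in Con(A/\sigma)$. For a homomorphism $f:A\to B$ and $\theta\in Con(B)$ put $f^*(\theta)=\{(a,b)\in A^2:(f(a),f(b))\in\theta\}$. A congruences operator over $\mathcal{A}$ is an assignment $A\mapsto\mathcal{K}(A)\subseteq Con(A)$ such that (i) $\Delta_A\in\mathcal{K}(A)$; (ii) $A/\sigma\in\mathcal{A}$ for $\sigma\in\mathcal{K}(A)$; (iii) for each isomorphism $f:A\to B$ in $\mathcal{A}$, $f^*$ restricts to an order isomorphism $\mathcal{K}(B)\to\mathcal{K}(A)$. It is a congruences presheaf if for all $A\in\mathcal{A}$, $\sigma\in\mathcal{K}(A)$, $\theta\in[\sigma,\nabla_A]$: $\theta\in\mathcal{K}(A)$ iff $\theta/\sigma\in\mathcal{K}(A/\sigma)$. A pair $(\theta,\neg\theta)$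 of congruences on $A$ is a pair of factor congruences if $\theta\cap\neg\theta=\Delta_A$ and $\theta\circ\neg\theta=\nabla_A$ (relational product; equivalently $\theta\cap\neg\theta=\Delta_A$, $\theta\lor\neg\theta=\nabla_A$ and $\theta,\neg\theta$ permute); it is a pair of factor congruences in $\mathcal{K}(A)$ if moreover both members are in $\mathcal{K}(A)$. $FC(A)$ is the set of congruences belonging to some such pair. A factor congruences presheaf is a congruences presheaf $\mathcal{K}$ such that for each $A\in\mathcal{A}$: (1) $\mathcal{K}(A)\subseteq FC(A)$; (2) for each $\theta\in\mathcal{K}(A)$ there is $\neg\theta\in\mathcal{K}(A)$ with $(\theta,\neg\theta)$ a pair of factor congruences; (3) if $\sigma\in\mathcal{K}(A)$, $\theta\in\mathcal{K}(A)\cap[\sigma,\nabla_A]$ and $(\theta,\neg\theta)$ is a pair of factor congruences in $\mathcal{K}(A)$, then $(\theta/\sigma,(\neg\theta\lor\sigma)/\sigma)$ is a pair of factor congruences in $\mathcal{K}(A/\sigma)$. $A\in\mathcal{A}$ has the $CBS_{\mathcal{K}}$-property iff: for every $B\in\mathcal{A}$, $\theta_B\in\mathcal{K}(B)$ and $\theta_A\in\mathcal{K}(A)$ with $A\cong B/\theta_B$ and $B\cong A/\theta_A$, one has $A\cong B$. CBS-sequences. Let $\theta\in\mathcal{K}(A)$ and let $f:A\to A/\theta$ be an isomorphism. For $\rho\in Con(A)$ let $f_*(\rho)=\{(f(a),f(b)):(a,b)\in\rho\}\in Con(A/\theta)$, and let $\hat f(\rho)$ be the unique congruence in $[\theta,\nabla_A]$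 with $\hat f(\rho)/\theta=f_*(\rho)$. Then $\hat f$ restricts to an order isomorphism $\mathcal{K}(A)\to\mathcal{K}(A)\cap[\theta,\nabla_A]$. For $\sigma\in\mathcal{K}(A)$ with $\sigma\subseteq\theta$ put $\langle\sigma\rangle_\theta=\{\zeta\in\mathcal{K}(A):\zeta\subseteq\theta,\ A/\sigma\cong A/\zeta\}$. Given $\zeta\in\langle\sigma\rangle_\theta$, define $\sigma_0=\Delta_A$, $\sigma_1=\zeta$, $\sigma_{n+2}=\hat f(\sigma_n)$ for $n\ge 0$ (so $\sigma_2=\theta$). A CBS-sequence (for $f,\theta,\zeta$) is a sequence $(\sigma_{2n}\lor\neg\sigma_{2n+1})_{n\ge 0}$ where, for some $\neg\hat f(\zeta)\in\mathcal{K}(A)$ such that $(\hat f(\zeta),\neg\hat f(\zeta))$ is a pair of factor congruences in $\mathcal{K}(A)$, one sets $\neg\sigma_1=\neg\zeta=\hat f^{-1}(\theta\lor\neg\hat f(\zeta))$ and $\neg\sigma_{2n+3}=\hat f(\neg\sigma_{2n+1})$ for $n\ge 0$. $A$ is $CBS_{\mathcal{K}}$-complete iff for every $\theta\in\mathcal{K}(A)$, every isomorphism $f:A\to A/\theta$ and every $\sigma\in\mathcal{K}(A)$ with $\sigma\subseteq\theta$, there exist $\zeta\in\langle\sigma\rangle_\theta$ and a CBS-sequence $(\sigma_{2n}\lor\neg\sigma_{2n+1})_{n\ge 0}$ for $f,\theta,\zeta$ such that: (1) the infimum $\sigma_\zeta$ in the ordered set $(\mathcal{K}(A),\subseteq)$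 of the family $(\sigma_{2n}\lor\neg\sigma_{2n+1})_{n\ge 1}$ exists; (2) there is $\neg\sigma_\zeta\in\mathcal{K}(A)$ such that $(\sigma_\zeta,\neg\sigma_\zeta)$ and $(\neg\zeta\cap\sigma_\zeta,\ \zeta\lor\neg\sigma_\zeta)$ are both pairs of factor congruences in $\mathcal{K}(A)$ (here $\neg\zeta=\neg\sigma_1$ is the congruence used in the CBS-sequence). *)

theory Defs
  imports "HOL-Library.Lub_Glb"
begin

section \<open>Algebras of a fixed type\<close>

text \<open>A type \<open>\<tau>\<close> is a partial map: \<open>dom \<tau>\<close> is the set of operation symbols and \<open>\<tau> g = Some n\<close>
  says that \<open>g\<close> is \<open>n\<close>-ary. No symbol at all, nullary symbols and empty carriers are all allowed.\<close>

type_synonym 'f signature = "'f \<rightharpoonup> nat"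

record ('f, 'u) alg =
  univ :: "'u set"
  oper :: "'f \<Rightarrow> 'u list \<Rightarrow> 'u"

definition op_args :: "'f signature \<Rightarrow> 'u set \<Rightarrow> 'f \<Rightarrow> 'u list set" where
  "op_args \<tau> X g = {xs. \<tau> g = Some (length xs) \<and> set xs \<subseteq> X}"

text \<open>The value \<open>undefined\<close> outside the proper arguments makes equality of records coincide with
  equality of algebras.\<close>

definition algebra_of_type :: "'f signature \<Rightarrow> ('f, 'u) alg \<Rightarrow> bool" where
  "algebra_of_type \<tau> A \<longleftrightarrow>
     (\<forall>g xs. (xs \<in> op_args \<tau> (univ A) g \<longrightarrow> oper A g xs \<in> univ A) \<and>
             (xs \<notin> op_args \<tau> (univ A) g \<longrightarrow> oper A g xs = undefined))"

definition alg_hom :: "'f signature \<Rightarrow> ('f, 'u) alg \<Rightarrow> ('f, 'u) alg \<Rightarrow> ('u \<Rightarrow> 'u) set" where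
  "alg_hom \<tau> A B = {f. f ` univ A \<subseteq> univ B \<and>
     (\<forall>g. \<forall>xs \<in> op_args \<tau> (univ A) g. f (oper A g xs) = oper B g (map f xs))}"

definition alg_iso :: "'f signature \<Rightarrow> ('f, 'u) alg \<Rightarrow> ('f, 'u) alg \<Rightarrow> ('u \<Rightarrow> 'u) set" where
  "alg_iso \<tau> A B = {f \<in> alg_hom \<tau> A B. bij_betw f (univ A) (univ B)}"

definition isomorphic :: "'f signature \<Rightarrow> ('f, 'u) alg \<Rightarrow> ('f, 'u) alg \<Rightarrow> bool" where
  "isomorphic \<tau> A B \<longleftrightarrow> alg_iso \<tau> A B \<noteq> {}"


section \<open>Congruences\<close>

definition Con :: "'f signature \<Rightarrow> ('f, 'u) alg \<Rightarrow> 'u rel set" where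
  "Con \<tau> A = {\<theta>. equiv (univ A) \<theta> \<and>
     (\<forall>g. \<forall>xs \<in> op_args \<tau> (univ A) g. \<forall>ys \<in> op_args \<tau> (univ A) g.
        list_all2 (\<lambda>x y. (x, y) \<in> \<theta>) xs ys \<longrightarrow> (oper A g xs, oper A g ys) \<in> \<theta>)}"

definition Delta :: "('f, 'u) alg \<Rightarrow> 'u rel" where
  "Delta A = Id_on (univ A)"

definition Nabla :: "('f, 'u) alg \<Rightarrow> 'u rel" where
  "Nabla A = univ A \<times> univ A"

definition cjoin :: "'f signature \<Rightarrow> ('f, 'u) alg \<Rightarrow> 'u rel \<Rightarrow> 'u rel \<Rightarrow> 'u rel" where
  "cjoin \<tau> A \<theta> \<sigma> = \<Inter> {\<rho> \<in> Con \<tau> A. \<theta> \<subseteq> \<rho> \<and> \<sigma> \<subseteq> \<rho>}"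

definition con_interval :: "'f signature \<Rightarrow> ('f, 'u) alg \<Rightarrow> 'u rel \<Rightarrow> 'u rel \<Rightarrow> 'u rel set" where
  "con_interval \<tau> A \<sigma> \<theta> = {\<rho> \<in> Con \<tau> A. \<sigma> \<subseteq> \<rho> \<and> \<rho> \<subseteq> \<theta>}"


section \<open>Quotients inside the universe\<close>

text \<open>All algebras of a category have their carriers in one universe, the type \<open>'u\<close>, and so must
  their quotients. In set theory a congruence class is itself an element of the universe; here the
  map \<open>c\<close> turns a class into an element of \<open>'u\<close>, and the class of \<open>x\<close> is represented by
  \<open>c (\<sigma> `` {x})\<close>. All that is required of \<open>c\<close> is that it separates the classes of each
  congruence, so that the quotient below is the usual quotient with its elements renamed. In a
  universe of sets one takes for \<open>c\<close> the identity; a choice of representatives is another instance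
  (\<open>class_coding_Eps\<close>).\<close>

definition class_coding ::
  "'f signature \<Rightarrow> ('u set \<Rightarrow> 'u) \<Rightarrow> ('f, 'u) alg set \<Rightarrow> bool" where
  "class_coding \<tau> c \<A> \<longleftrightarrow> (\<forall>A \<in> \<A>. \<forall>\<sigma> \<in> Con \<tau> A. inj_on c (univ A // \<sigma>))"

lemma class_coding_Eps: "class_coding \<tau> (\<lambda>X. SOME x. x \<in> X) \<A>"
  unfolding class_coding_def
proof (intro ballI inj_onI)
  fix A \<sigma> X Y
  assume \<sigma>: "\<sigma> \<in> Con \<tau> A" and XY: "X \<in> univ A // \<sigma>" "Y \<in> univ A // \<sigma>"
    and eq: "(SOME x. x \<in> X) = (SOME x. x \<in> Y)"
  have e: "equiv (univ A) \<sigma>" using \<sigma> by (simp add: Con_def)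
  have "X \<noteq> {}" "Y \<noteq> {}" using e XY in_quotient_imp_non_empty by blast+
  then have "(SOME x. x \<in> X) \<in> X" "(SOME x. x \<in> Y) \<in> Y" by (simp_all add: some_in_eq)
  then show "X = Y" using eq quotient_disj[OF e XY] by auto
qed

definition cls :: "('u set \<Rightarrow> 'u) \<Rightarrow> 'u rel \<Rightarrow> 'u \<Rightarrow> 'u" where
  "cls c \<sigma> x = c (\<sigma> `` {x})"

definition quot ::
  "'f signature \<Rightarrow> ('u set \<Rightarrow> 'u) \<Rightarrow> ('f, 'u) alg \<Rightarrow> 'u rel \<Rightarrow> ('f, 'u) alg" where
  "quot \<tau> c A \<sigma> =
     \<lparr>univ = cls c \<sigma> ` univ A,
      oper = (\<lambda>g ys. if ys \<in> op_args \<tau> (cls c \<sigma> ` univ A) g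
        then THE z. \<exists>xs \<in> op_args \<tau> (univ A) g.
               map (cls c \<sigma>) xs = ys \<and> z = cls c \<sigma> (oper A g xs)
        else undefined)\<rparr>"

text \<open>The congruence \<open>\<theta>/\<sigma>\<close> of \<open>A/\<sigma>\<close>.\<close>

definition quot_con :: "('u set \<Rightarrow> 'u) \<Rightarrow> 'u rel \<Rightarrow> 'u rel \<Rightarrow> 'u rel" where
  "quot_con c \<theta> \<sigma> = {(cls c \<sigma> x, cls c \<sigma> y) | x y. (x, y) \<in> \<theta>}"

definition pullback :: "('f, 'u) alg \<Rightarrow> ('u \<Rightarrow> 'u) \<Rightarrow> 'u rel \<Rightarrow> 'u rel" where
  "pullback A f \<theta> = {(a, b). a \<in> univ A \<and> b \<in> univ A \<and> (f a, f b) \<in> \<theta>}"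

definition pushforward :: "('u \<Rightarrow> 'u) \<Rightarrow> 'u rel \<Rightarrow> 'u rel" where
  "pushforward f \<rho> = {(f a, f b) | a b. (a, b) \<in> \<rho>}"


section \<open>Congruences operators and presheaves\<close>

text \<open>The morphisms of a category of algebras are all homomorphisms between its objects, so it is
  given by its collection of objects, which need not be closed under isomorphism.\<close>

definition category_of_algebras :: "'f signature \<Rightarrow> ('f, 'u) alg set \<Rightarrow> bool" where
  "category_of_algebras \<tau> \<A> \<longleftrightarrow> (\<forall>A \<in> \<A>. algebra_of_type \<tau> A)"

definition congruences_operator ::
  "'f signature \<Rightarrow> ('u set \<Rightarrow> 'u) \<Rightarrow> ('f, 'u) alg set \<Rightarrow> (('f, 'u) alg \<Rightarrow> 'u rel set) \<Rightarrow> bool" where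
  "congruences_operator \<tau> c \<A> \<K> \<longleftrightarrow>
     (\<forall>A \<in> \<A>. \<K> A \<subseteq> Con \<tau> A \<and> Delta A \<in> \<K> A \<and> (\<forall>\<sigma> \<in> \<K> A. quot \<tau> c A \<sigma> \<in> \<A>)) \<and>
     (\<forall>A \<in> \<A>. \<forall>B \<in> \<A>. \<forall>f \<in> alg_iso \<tau> A B.
        bij_betw (pullback A f) (\<K> B) (\<K> A) \<and>
        (\<forall>\<theta> \<in> \<K> B. \<forall>\<theta>' \<in> \<K> B. \<theta> \<subseteq> \<theta>' \<longleftrightarrow> pullback A f \<theta> \<subseteq> pullback A f \<theta>'))"

definition congruences_presheaf ::
  "'f signature \<Rightarrow> ('u set \<Rightarrow> 'u) \<Rightarrow> ('f, 'u) alg set \<Rightarrow> (('f, 'u) alg \<Rightarrow> 'u rel set) \<Rightarrow> bool" where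
  "congruences_presheaf \<tau> c \<A> \<K> \<longleftrightarrow>
     congruences_operator \<tau> c \<A> \<K> \<and>
     (\<forall>A \<in> \<A>. \<forall>\<sigma> \<in> \<K> A. \<forall>\<theta> \<in> con_interval \<tau> A \<sigma> (Nabla A).
        \<theta> \<in> \<K> A \<longleftrightarrow> quot_con c \<theta> \<sigma> \<in> \<K> (quot \<tau> c A \<sigma>))"

definition factor_pair :: "'f signature \<Rightarrow> ('f, 'u) alg \<Rightarrow> 'u rel \<Rightarrow> 'u rel \<Rightarrow> bool" where
  "factor_pair \<tau> A \<theta> \<theta>' \<longleftrightarrow>
     \<theta> \<in> Con \<tau> A \<and> \<theta>' \<in> Con \<tau> A \<and> \<theta> \<inter> \<theta>' = Delta A \<and> \<theta> O \<theta>' = Nabla A"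

definition factor_pair_in ::
  "'f signature \<Rightarrow> (('f, 'u) alg \<Rightarrow> 'u rel set) \<Rightarrow> ('f, 'u) alg \<Rightarrow> 'u rel \<Rightarrow> 'u rel \<Rightarrow> bool" where
  "factor_pair_in \<tau> \<K> A \<theta> \<theta>' \<longleftrightarrow> factor_pair \<tau> A \<theta> \<theta>' \<and> \<theta> \<in> \<K> A \<and> \<theta>' \<in> \<K> A"

definition FC :: "'f signature \<Rightarrow> ('f, 'u) alg \<Rightarrow> 'u rel set" where
  "FC \<tau> A = {\<theta>. \<exists>\<theta>'. factor_pair \<tau> A \<theta> \<theta>' \<or> factor_pair \<tau> A \<theta>' \<theta>}"

definition factor_congruences_presheaf ::
  "'f signature \<Rightarrow> ('u set \<Rightarrow> 'u) \<Rightarrow> ('f, 'u) alg set \<Rightarrow> (('f, 'u) alg \<Rightarrow> 'u rel set) \<Rightarrow> bool" where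
  "factor_congruences_presheaf \<tau> c \<A> \<K> \<longleftrightarrow>
     congruences_presheaf \<tau> c \<A> \<K> \<and>
     (\<forall>A \<in> \<A>.
        \<K> A \<subseteq> FC \<tau> A \<and>
        (\<forall>\<theta> \<in> \<K> A. \<exists>\<theta>' \<in> \<K> A. factor_pair \<tau> A \<theta> \<theta>') \<and>
        (\<forall>\<sigma> \<in> \<K> A. \<forall>\<theta> \<in> \<K> A \<inter> con_interval \<tau> A \<sigma> (Nabla A). \<forall>\<theta>'.
           factor_pair_in \<tau> \<K> A \<theta> \<theta>' \<longrightarrow>
           factor_pair_in \<tau> \<K> (quot \<tau> c A \<sigma>)
             (quot_con c \<theta> \<sigma>) (quot_con c (cjoin \<tau> A \<theta>' \<sigma>) \<sigma>)))"


section \<open>The Cantor-Bernstein-Schroeder property\<close>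

definition CBS_property ::
  "'f signature \<Rightarrow> ('u set \<Rightarrow> 'u) \<Rightarrow> ('f, 'u) alg set \<Rightarrow> (('f, 'u) alg \<Rightarrow> 'u rel set)
     \<Rightarrow> ('f, 'u) alg \<Rightarrow> bool" where
  "CBS_property \<tau> c \<A> \<K> A \<longleftrightarrow>
     (\<forall>B \<in> \<A>. \<forall>\<theta>B \<in> \<K> B. \<forall>\<theta>A \<in> \<K> A.
        isomorphic \<tau> A (quot \<tau> c B \<theta>B) \<and> isomorphic \<tau> B (quot \<tau> c A \<theta>A) \<longrightarrow> isomorphic \<tau> A B)"


section \<open>CBS-sequences and completeness\<close>

definition fhat ::
  "'f signature \<Rightarrow> ('u set \<Rightarrow> 'u) \<Rightarrow> ('f, 'u) alg \<Rightarrow> 'u rel \<Rightarrow> ('u \<Rightarrow> 'u) \<Rightarrow> 'u rel \<Rightarrow> 'u rel" where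
  "fhat \<tau> c A \<theta> f \<rho> =
     (THE \<chi>. \<chi> \<in> con_interval \<tau> A \<theta> (Nabla A) \<and> quot_con c \<chi> \<theta> = pushforward f \<rho>)"

definition fhat_inv ::
  "'f signature \<Rightarrow> ('u set \<Rightarrow> 'u) \<Rightarrow> ('f, 'u) alg \<Rightarrow> 'u rel \<Rightarrow> ('u \<Rightarrow> 'u) \<Rightarrow> 'u rel \<Rightarrow> 'u rel" where
  "fhat_inv \<tau> c A \<theta> f = inv_into (Con \<tau> A) (fhat \<tau> c A \<theta> f)"

definition iso_class ::
  "'f signature \<Rightarrow> ('u set \<Rightarrow> 'u) \<Rightarrow> (('f, 'u) alg \<Rightarrow> 'u rel set) \<Rightarrow> ('f, 'u) alg
     \<Rightarrow> 'u rel \<Rightarrow> 'u rel \<Rightarrow> 'u rel set" where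
  "iso_class \<tau> c \<K> A \<theta> \<sigma> =
     {\<zeta> \<in> \<K> A. \<zeta> \<subseteq> \<theta> \<and> isomorphic \<tau> (quot \<tau> c A \<sigma>) (quot \<tau> c A \<zeta>)}"

fun cbs_sigma ::
  "'f signature \<Rightarrow> ('u set \<Rightarrow> 'u) \<Rightarrow> ('f, 'u) alg \<Rightarrow> 'u rel \<Rightarrow> ('u \<Rightarrow> 'u) \<Rightarrow> 'u rel
     \<Rightarrow> nat \<Rightarrow> 'u rel" where
  "cbs_sigma \<tau> c A \<theta> f \<zeta> 0 = Delta A"
| "cbs_sigma \<tau> c A \<theta> f \<zeta> (Suc 0) = \<zeta>"
| "cbs_sigma \<tau> c A \<theta> f \<zeta> (Suc (Suc n)) = fhat \<tau> c A \<theta> f (cbs_sigma \<tau> c A \<theta> f \<zeta> n)"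

text \<open>\<open>cbs_neg \<dots> \<zeta>' n\<close> is \<open>\<not>\<sigma>\<^sub>2\<^sub>n\<^sub>+\<^sub>1\<close>, where \<open>\<zeta>'\<close> is \<open>\<not>\<zeta>\<close>.\<close>

primrec cbs_neg ::
  "'f signature \<Rightarrow> ('u set \<Rightarrow> 'u) \<Rightarrow> ('f, 'u) alg \<Rightarrow> 'u rel \<Rightarrow> ('u \<Rightarrow> 'u) \<Rightarrow> 'u rel
     \<Rightarrow> nat \<Rightarrow> 'u rel" where
  "cbs_neg \<tau> c A \<theta> f \<zeta>' 0 = \<zeta>'"
| "cbs_neg \<tau> c A \<theta> f \<zeta>' (Suc n) = fhat \<tau> c A \<theta> f (cbs_neg \<tau> c A \<theta> f \<zeta>' n)"

text \<open>\<open>s\<close> is a CBS-sequence for \<open>f\<close>, \<open>\<theta>\<close>, \<open>\<zeta>\<close> in which \<open>\<zeta>'\<close> is used as \<open>\<not>\<zeta>\<close>; the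
  congruence \<open>\<nu>\<close> is the chosen complement of the image of \<open>\<zeta>\<close>.\<close>

definition CBS_sequence ::
  "'f signature \<Rightarrow> ('u set \<Rightarrow> 'u) \<Rightarrow> (('f, 'u) alg \<Rightarrow> 'u rel set) \<Rightarrow> ('f, 'u) alg
     \<Rightarrow> 'u rel \<Rightarrow> ('u \<Rightarrow> 'u) \<Rightarrow> 'u rel \<Rightarrow> 'u rel \<Rightarrow> (nat \<Rightarrow> 'u rel) \<Rightarrow> bool" where
  "CBS_sequence \<tau> c \<K> A \<theta> f \<zeta> \<zeta>' s \<longleftrightarrow>
     (\<exists>\<nu> \<in> \<K> A. factor_pair_in \<tau> \<K> A (fhat \<tau> c A \<theta> f \<zeta>) \<nu> \<and>
        \<zeta>' = fhat_inv \<tau> c A \<theta> f (cjoin \<tau> A \<theta> \<nu>)) \<and>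
     (\<forall>n. s n = cjoin \<tau> A (cbs_sigma \<tau> c A \<theta> f \<zeta> (2 * n)) (cbs_neg \<tau> c A \<theta> f \<zeta>' n))"

definition CBS_complete ::
  "'f signature \<Rightarrow> ('u set \<Rightarrow> 'u) \<Rightarrow> (('f, 'u) alg \<Rightarrow> 'u rel set) \<Rightarrow> ('f, 'u) alg \<Rightarrow> bool" where
  "CBS_complete \<tau> c \<K> A \<longleftrightarrow>
     (\<forall>\<theta> \<in> \<K> A. \<forall>f \<in> alg_iso \<tau> A (quot \<tau> c A \<theta>). \<forall>\<sigma> \<in> \<K> A. \<sigma> \<subseteq> \<theta> \<longrightarrow>
        (\<exists>\<zeta> \<in> iso_class \<tau> c \<K> A \<theta> \<sigma>. \<exists>\<zeta>' s. CBS_sequence \<tau> c \<K> A \<theta> f \<zeta> \<zeta>' s \<and>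
           (\<exists>\<sigma>\<zeta>. isGlb (\<K> A) (s ` {1..}) \<sigma>\<zeta> \<and>
              (\<exists>\<sigma>\<zeta>' \<in> \<K> A.
                 factor_pair_in \<tau> \<K> A \<sigma>\<zeta> \<sigma>\<zeta>' \<and>
                 factor_pair_in \<tau> \<K> A (\<zeta>' \<inter> \<sigma>\<zeta>) (cjoin \<tau> A \<zeta> \<sigma>\<zeta>')))))"

end

theory Submission
  imports Defs
begin

text \<open>If \<open>A\<close> has the Cantor-Bernstein-Schroeder property and \<open>A \<cong> A/\<theta>\<close> with \<open>\<sigma> \<subseteq> \<theta>\<close>, then
  \<open>A/\<theta>\<close> is a quotient of \<open>A/\<sigma>\<close>, and the property gives \<open>A \<cong> A/\<sigma>\<close>. The least congruence is therefore an admissible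
  \<open>\<zeta>\<close>, and for it the infimum that completeness asks for is trivial (\<open>CBS_imp_complete\<close>).

  Conversely, from \<open>A \<cong> B/\<theta>\<^sub>B\<close> and \<open>B \<cong> A/\<sigma>\<close> one gets a congruence \<open>\<theta> \<supseteq> \<sigma>\<close> and an isomorphism
  \<open>f\<close> from \<open>A\<close> to \<open>A/\<theta>\<close>, and it has to be shown that \<open>A \<cong> A/\<sigma>\<close>. Completeness replaces \<open>\<sigma>\<close> by
  some \<open>\<zeta>\<close> with \<open>A/\<sigma> \<cong> A/\<zeta>\<close> and supplies a congruence \<open>\<iota>\<close>, the infimum of a tail of the
  CBS-sequence, with complement \<open>\<iota>'\<close>. Let \<open>\<zeta>'\<close> be the complement of \<open>\<zeta>\<close> used in that sequence.
  The isomorphism \<open>f\<close> induces an order isomorphism of congruences which shifts the CBS-sequence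
  by one step; as its initial term is \<open>\<zeta>'\<close>, that order isomorphism takes \<open>\<zeta>' \<inter> \<iota>\<close> to \<open>\<iota>\<close>
  (\<open>fhat_inter_infimum\<close>), and so \<open>A/(\<zeta>' \<inter> \<iota>) \<cong> A/\<iota>\<close>. Now \<open>A\<close> is the product of
  \<open>A/(\<zeta>' \<inter> \<iota>)\<close> and \<open>A/(\<zeta> \<or> \<iota>')\<close>, while \<open>A/\<zeta>\<close> is the product of \<open>A/\<iota>\<close> and
  \<open>A/(\<zeta> \<or> \<iota>')\<close>. The factors agree, hence \<open>A \<cong> A/\<zeta>\<close> (\<open>isomorphic_if_same_factors\<close>).
  In the theorem on sets, \<open>\<zeta>' \<inter> \<iota>\<close> and \<open>\<iota>\<close> play the part of the set of points that are moved and
  its image, and \<open>\<zeta> \<or> \<iota>'\<close> that of the set of points left fixed.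

  Quotients of quotients are handled by one relation: \<open>is_quotient \<tau> A \<alpha> C\<close> says that \<open>C\<close> is the
  image of \<open>A\<close> under a homomorphism with kernel \<open>\<alpha>\<close>. The coding of the classes and the operations
  of a quotient algebra are dealt with once, in \<open>cls_quotient_map\<close>.\<close>


section \<open>Surjective homomorphisms with a prescribed kernel\<close>

text \<open>The relation \<open>pullback A p Id\<close> is the kernel of \<open>p\<close>.\<close>

definition quotient_maps ::
  "'f signature \<Rightarrow> ('f, 'u) alg \<Rightarrow> 'u rel \<Rightarrow> ('f, 'u) alg \<Rightarrow> ('u \<Rightarrow> 'u) set" where
  "quotient_maps \<tau> A \<alpha> C =
     {p \<in> alg_hom \<tau> A C. p ` univ A = univ C \<and> pullback A p Id = \<alpha>}"

definition is_quotient ::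
  "'f signature \<Rightarrow> ('f, 'u) alg \<Rightarrow> 'u rel \<Rightarrow> ('f, 'u) alg \<Rightarrow> bool" where
  "is_quotient \<tau> A \<alpha> C \<longleftrightarrow> quotient_maps \<tau> A \<alpha> C \<noteq> {}"

lemma quotient_mapsD:
  assumes "p \<in> quotient_maps \<tau> A \<alpha> C"
  shows "p ` univ A = univ C"
    and "xs \<in> op_args \<tau> (univ A) g \<Longrightarrow> p (oper A g xs) = oper C g (map p xs)"
    and "x \<in> univ A \<Longrightarrow> y \<in> univ A \<Longrightarrow> p x = p y \<longleftrightarrow> (x, y) \<in> \<alpha>"
    and "x \<in> univ A \<Longrightarrow> p x \<in> univ C"
  using assms by (auto simp: quotient_maps_def alg_hom_def pullback_def)

lemma oper_closed:
  "algebra_of_type \<tau> A \<Longrightarrow> xs \<in> op_args \<tau> (univ A) g \<Longrightarrow> oper A g xs \<in> univ A"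
  by (simp add: algebra_of_type_def)

lemma map_op_args:
  "xs \<in> op_args \<tau> X g \<Longrightarrow> p ` X \<subseteq> Y \<Longrightarrow> map p xs \<in> op_args \<tau> Y g"
  by (auto simp: op_args_def)

lemma op_args_lift:
  assumes "ys \<in> op_args \<tau> (p ` X) g"
  obtains xs where "xs \<in> op_args \<tau> X g" "map p xs = ys"
proof -
  have "ys \<in> lists (p ` X)" using assms by (auto simp: op_args_def)
  then obtain xs where "xs \<in> lists X" "ys = map p xs" unfolding lists_image by blast
  then show thesis using assms that[of xs] by (auto simp: op_args_def)
qed

lemma Con_sub: "\<theta> \<in> Con \<tau> A \<Longrightarrow> \<theta> \<subseteq> univ A \<times> univ A"
  by (auto simp: Con_def equiv_type)

lemma Con_equiv: "\<theta> \<in> Con \<tau> A \<Longrightarrow> equiv (univ A) \<theta>"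
  by (simp add: Con_def)

lemma Con_oper:
  assumes "\<theta> \<in> Con \<tau> A" "xs \<in> op_args \<tau> (univ A) g" "ys \<in> op_args \<tau> (univ A) g"
    "list_all2 (\<lambda>x y. (x, y) \<in> \<theta>) xs ys"
  shows "(oper A g xs, oper A g ys) \<in> \<theta>"
  using assms by (simp add: Con_def)

lemma Con_refl: "\<theta> \<in> Con \<tau> A \<Longrightarrow> x \<in> univ A \<Longrightarrow> (x, x) \<in> \<theta>"
  using Con_equiv equiv_class_self by fastforce

lemma Con_sym: "\<theta> \<in> Con \<tau> A \<Longrightarrow> (x, y) \<in> \<theta> \<Longrightarrow> (y, x) \<in> \<theta>"
  using Con_equiv by (metis equivE symD)

lemma Con_trans: "\<theta> \<in> Con \<tau> A \<Longrightarrow> (x, y) \<in> \<theta> \<Longrightarrow> (y, z) \<in> \<theta> \<Longrightarrow> (x, z) \<in> \<theta>"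
  using Con_equiv by (metis equivE transD)

text \<open>The coding of classes is injective on \<open>univ A // \<sigma>\<close>, so \<open>x\<close> and \<open>y\<close> have the same code
  precisely when \<open>(x, y) \<in> \<sigma>\<close>; compatibility of \<open>\<sigma>\<close> makes the definite description in \<open>quot\<close>
  well defined.\<close>

lemma cls_quotient_map:
  assumes c: "class_coding \<tau> c \<A>" and A: "A \<in> \<A>" and \<sigma>: "\<sigma> \<in> Con \<tau> A"
  shows "cls c \<sigma> \<in> quotient_maps \<tau> A \<sigma> (quot \<tau> c A \<sigma>)"
proof -
  have inj: "inj_on c (univ A // \<sigma>)" using c A \<sigma> by (simp add: class_coding_def)
  have eq: "cls c \<sigma> x = cls c \<sigma> y \<longleftrightarrow> (x, y) \<in> \<sigma>" if "x \<in> univ A" "y \<in> univ A" for x y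
    using that inj eq_equiv_class_iff[OF Con_equiv[OF \<sigma>] that]
    by (simp add: cls_def inj_on_eq_iff quotientI)
  have "cls c \<sigma> (oper A g xs) = oper (quot \<tau> c A \<sigma>) g (map (cls c \<sigma>) xs)"
    if xs: "xs \<in> op_args \<tau> (univ A) g" for g xs
  proof -
    have uniq: "cls c \<sigma> (oper A g ys) = cls c \<sigma> (oper A g xs)"
      if ys: "ys \<in> op_args \<tau> (univ A) g" and m: "map (cls c \<sigma>) ys = map (cls c \<sigma>) xs" for ys
    proof -
      have "length ys = length xs" using m map_eq_imp_length_eq by blast
      moreover have "(ys ! i, xs ! i) \<in> \<sigma>" if "i < length xs" for i
      proof -
        have "cls c \<sigma> (ys ! i) = cls c \<sigma> (xs ! i)"
          using m that \<open>length ys = length xs\<close> by (metis nth_map)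
        moreover have "ys ! i \<in> univ A" "xs ! i \<in> univ A"
          using xs ys that \<open>length ys = length xs\<close> by (auto simp: op_args_def)
        ultimately show ?thesis using eq by simp
      qed
      ultimately have "list_all2 (\<lambda>x y. (x, y) \<in> \<sigma>) ys xs" by (simp add: list_all2_conv_all_nth)
      then have "(oper A g ys, oper A g xs) \<in> \<sigma>" by (rule Con_oper[OF \<sigma> ys xs])
      then show ?thesis using equiv_class_eq[OF Con_equiv[OF \<sigma>]] by (simp add: cls_def)
    qed
    have "(THE z. \<exists>ys\<in>op_args \<tau> (univ A) g. map (cls c \<sigma>) ys = map (cls c \<sigma>) xs
               \<and> z = cls c \<sigma> (oper A g ys)) = cls c \<sigma> (oper A g xs)"
      by (rule the_equality) (use xs uniq in blast)+
    moreover have "map (cls c \<sigma>) xs \<in> op_args \<tau> (cls c \<sigma> ` univ A) g"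
      using xs by (rule map_op_args) simp
    ultimately show ?thesis by (simp add: quot_def)
  qed
  moreover have "pullback A (cls c \<sigma>) Id = \<sigma>"
    using eq Con_sub[OF \<sigma>] by (auto simp: pullback_def)
  ultimately show ?thesis by (simp add: quotient_maps_def alg_hom_def quot_def)
qed

lemma iso_iff_quotient_map: "f \<in> alg_iso \<tau> A B \<longleftrightarrow> f \<in> quotient_maps \<tau> A (Delta A) B"
  by (auto simp: alg_iso_def quotient_maps_def bij_betw_def Delta_def pullback_def inj_on_def)

text \<open>This puts isomorphisms and quotients on the same footing, so that the isomorphism theorems
  below cover both.\<close>

lemma isomorphic_iff: "isomorphic \<tau> A B \<longleftrightarrow> is_quotient \<tau> A (Delta A) B"
  unfolding isomorphic_def is_quotient_def ex_in_conv[symmetric] iso_iff_quotient_map ..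

lemma is_quotient_self: "is_quotient \<tau> A (Delta A) A"
proof -
  have "id \<in> quotient_maps \<tau> A (Delta A) A"
    by (auto simp: quotient_maps_def alg_hom_def Delta_def pullback_def)
  then show ?thesis by (auto simp: is_quotient_def)
qed

lemma quotient_map_comp:
  assumes p: "p \<in> quotient_maps \<tau> A \<alpha> B" and q: "q \<in> quotient_maps \<tau> B \<beta> C"
  shows "q \<circ> p \<in> quotient_maps \<tau> A (pullback A p \<beta>) C"
proof -
  have "(q \<circ> p) ` univ A = univ C"
    using quotient_mapsD(1)[OF p] quotient_mapsD(1)[OF q] by (metis image_comp)
  moreover have "(q \<circ> p) (oper A g xs) = oper C g (map (q \<circ> p) xs)"
    if "xs \<in> op_args \<tau> (univ A) g" for g xs
    using quotient_mapsD(2)[OF p that] quotient_mapsD(2)[OF q map_op_args[OF that]]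
      quotient_mapsD(1)[OF p] by simp
  moreover have "pullback A (q \<circ> p) Id = pullback A p \<beta>"
    using quotient_mapsD(3)[OF q] quotient_mapsD(4)[OF p] by (auto simp: pullback_def)
  ultimately show ?thesis by (simp add: quotient_maps_def alg_hom_def)
qed

text \<open>The homomorphism theorem: \<open>q\<close> factors through \<open>p\<close> when its kernel is the larger one.
  Every list of arguments in \<open>B\<close> lifts along \<open>p\<close>, which makes the factor a homomorphism.\<close>

lemma quotient_map_factor:
  assumes A: "algebra_of_type \<tau> A"
    and p: "p \<in> quotient_maps \<tau> A \<alpha> B" and q: "q \<in> quotient_maps \<tau> A \<theta> C" and sub: "\<alpha> \<subseteq> \<theta>"
  shows "is_quotient \<tau> B (pushforward p \<theta>) C"
proof -
  define r where "r = q \<circ> inv_into (univ A) p"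
  have r: "r (p a) = q a" if "a \<in> univ A" for a
  proof -
    let ?a = "inv_into (univ A) p (p a)"
    have "?a \<in> univ A" "p ?a = p a" using that by (auto intro: inv_into_into f_inv_into_f)
    then have "(?a, a) \<in> \<theta>" using quotient_mapsD(3)[OF p] sub that by blast
    then show ?thesis using quotient_mapsD(3)[OF q] \<open>?a \<in> univ A\<close> that by (simp add: r_def)
  qed
  have B: "univ B = p ` univ A" using quotient_mapsD(1)[OF p] by simp
  have "r ` univ B = univ C"
    using r quotient_mapsD(1)[OF q] unfolding B image_image by (metis image_cong)
  moreover have "r (oper B g ys) = oper C g (map r ys)" if "ys \<in> op_args \<tau> (univ B) g" for g ys
  proof -
    obtain xs where xs: "xs \<in> op_args \<tau> (univ A) g" and ys: "map p xs = ys"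
      using \<open>ys \<in> _\<close> unfolding B by (rule op_args_lift)
    have "map r ys = map q xs" unfolding ys[symmetric] using xs r by (auto simp: op_args_def)
    moreover have "oper B g ys = p (oper A g xs)"
      using quotient_mapsD(2)[OF p xs] ys by simp
    ultimately show ?thesis
      using r[OF oper_closed[OF A xs]] quotient_mapsD(2)[OF q xs] by simp
  qed
  moreover have "pullback B r Id = pushforward p \<theta>"
  proof -
    have \<theta>: "\<theta> \<subseteq> univ A \<times> univ A" using q by (auto simp: quotient_maps_def pullback_def)
    show ?thesis
    proof (intro equalityI subrelI)
      fix x y assume "(x, y) \<in> pullback B r Id"
      then obtain a b where ab: "a \<in> univ A" "b \<in> univ A" "x = p a" "y = p b" "r x = r y"
        unfolding pullback_def B by blast
      then have "(a, b) \<in> \<theta>" using r quotient_mapsD(3)[OF q] by simp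
      then show "(x, y) \<in> pushforward p \<theta>" using ab by (auto simp: pushforward_def)
    next
      fix x y assume "(x, y) \<in> pushforward p \<theta>"
      then obtain a b where ab: "(a, b) \<in> \<theta>" "x = p a" "y = p b"
        unfolding pushforward_def by blast
      then have "a \<in> univ A" "b \<in> univ A" using \<theta> by auto
      then show "(x, y) \<in> pullback B r Id"
        using ab r quotient_mapsD(3)[OF q] by (simp add: pullback_def B)
    qed
  qed
  ultimately have "r \<in> quotient_maps \<tau> B (pushforward p \<theta>) C"
    by (simp add: quotient_maps_def alg_hom_def)
  then show ?thesis by (auto simp: is_quotient_def)
qed

lemma is_quotient_unique:
  assumes A: "algebra_of_type \<tau> A" and C: "is_quotient \<tau> A \<alpha> C" and D: "is_quotient \<tau> A \<alpha> D"
  shows "isomorphic \<tau> C D"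
proof -
  obtain p q where p: "p \<in> quotient_maps \<tau> A \<alpha> C" and q: "q \<in> quotient_maps \<tau> A \<alpha> D"
    using C D by (auto simp: is_quotient_def)
  have "pushforward p \<alpha> = Delta C"
  proof (intro equalityI subrelI)
    fix x y assume "(x, y) \<in> pushforward p \<alpha>"
    then show "(x, y) \<in> Delta C"
      using p by (auto simp: pushforward_def Delta_def quotient_maps_def pullback_def)
  next
    fix x y assume "(x, y) \<in> Delta C"
    then obtain a where "a \<in> univ A" "x = p a" "y = p a"
      using quotient_mapsD(1)[OF p] by (auto simp: Delta_def)
    moreover from this have "(a, a) \<in> \<alpha>" using quotient_mapsD(3)[OF p] by blast
    ultimately show "(x, y) \<in> pushforward p \<alpha>" by (auto simp: pushforward_def)
  qed
  then show ?thesis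
    using quotient_map_factor[OF A p q] by (simp add: isomorphic_iff)
qed

lemma is_quotient_isomorphic:
  assumes "is_quotient \<tau> A \<alpha> C" "isomorphic \<tau> C D"
  shows "is_quotient \<tau> A \<alpha> D"
proof -
  obtain p q where p: "p \<in> quotient_maps \<tau> A \<alpha> C" and q: "q \<in> quotient_maps \<tau> C (Delta C) D"
    using assms by (auto simp: is_quotient_def isomorphic_iff)
  have "pullback A p (Delta C) = \<alpha>"
    using p by (auto simp: quotient_maps_def pullback_def Delta_def)
  then show ?thesis using quotient_map_comp[OF p q] by (auto simp: is_quotient_def)
qed

lemma isomorphic_trans: "isomorphic \<tau> A B \<Longrightarrow> isomorphic \<tau> B C \<Longrightarrow> isomorphic \<tau> A C"
  using is_quotient_isomorphic[of \<tau> A "Delta A" B C] by (simp add: isomorphic_iff)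

lemma isomorphic_refl: "isomorphic \<tau> A A"
  by (simp add: isomorphic_iff is_quotient_self)

lemma isomorphic_sym:
  "algebra_of_type \<tau> A \<Longrightarrow> isomorphic \<tau> A B \<Longrightarrow> isomorphic \<tau> B A"
  using is_quotient_unique[OF _ _ is_quotient_self, of \<tau> A B] by (simp add: isomorphic_iff)


section \<open>Algebras with isomorphic factors\<close>

lemma factor_pair_solve:
  assumes fp: "factor_pair \<tau> B \<gamma> \<delta>"
    and v: "v \<in> quotient_maps \<tau> B \<gamma> C" and v': "v' \<in> quotient_maps \<tau> B \<delta> D"
    and x: "x \<in> univ C" and y: "y \<in> univ D"
  shows "\<exists>b \<in> univ B. v b = x \<and> v' b = y"
proof -
  obtain b1 b2 where b: "b1 \<in> univ B" "v b1 = x" "b2 \<in> univ B" "v' b2 = y"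
    using x y unfolding quotient_mapsD(1)[OF v, symmetric] quotient_mapsD(1)[OF v', symmetric]
    by blast
  have "(b1, b2) \<in> \<gamma> O \<delta>" using fp b by (simp add: factor_pair_def Nabla_def)
  then obtain b where "(b1, b) \<in> \<gamma>" "(b, b2) \<in> \<delta>" by blast
  moreover have "b \<in> univ B"
    using \<open>(b1, b) \<in> \<gamma>\<close> fp Con_sub by (fastforce simp: factor_pair_def)
  ultimately show ?thesis using b quotient_mapsD(3)[OF v] quotient_mapsD(3)[OF v'] by metis
qed

lemma factor_pair_inj:
  assumes fp: "factor_pair \<tau> B \<gamma> \<delta>"
    and v: "v \<in> quotient_maps \<tau> B \<gamma> C" and v': "v' \<in> quotient_maps \<tau> B \<delta> D"
    and b: "b \<in> univ B" "b' \<in> univ B" "v b = v b'" "v' b = v' b'"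
  shows "b = b'"
proof -
  have "(b, b') \<in> \<gamma> \<inter> \<delta>" using b quotient_mapsD(3)[OF v] quotient_mapsD(3)[OF v'] by blast
  then have "(b, b') \<in> Delta B" using fp unfolding factor_pair_def by metis
  then show ?thesis by (auto simp: Delta_def)
qed

text \<open>A pair of factor congruences on \<open>A\<close> presents \<open>A\<close> as the direct product of the two
  quotients, hence both algebras are isomorphic to the product of \<open>C\<close> and \<open>D\<close>. The product need not
  have a copy in the universe, so the isomorphism is built directly, by matching coordinates.\<close>

lemma isomorphic_if_same_factors:
  assumes A: "algebra_of_type \<tau> A" and B: "algebra_of_type \<tau> B"
    and fA: "factor_pair \<tau> A \<alpha> \<beta>" "is_quotient \<tau> A \<alpha> C" "is_quotient \<tau> A \<beta> D"
    and fB: "factor_pair \<tau> B \<gamma> \<delta>" "is_quotient \<tau> B \<gamma> C" "is_quotient \<tau> B \<delta> D"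
  shows "isomorphic \<tau> A B"
proof -
  obtain u u' where u: "u \<in> quotient_maps \<tau> A \<alpha> C" and u': "u' \<in> quotient_maps \<tau> A \<beta> D"
    using fA by (auto simp: is_quotient_def)
  obtain v v' where v: "v \<in> quotient_maps \<tau> B \<gamma> C" and v': "v' \<in> quotient_maps \<tau> B \<delta> D"
    using fB by (auto simp: is_quotient_def)
  have "\<exists>b \<in> univ B. v b = u a \<and> v' b = u' a" if "a \<in> univ A" for a
    using that factor_pair_solve[OF fB(1) v v'] quotient_mapsD(4)[OF u] quotient_mapsD(4)[OF u']
    by blast
  then obtain \<phi> where
    \<phi>: "a \<in> univ A \<Longrightarrow> \<phi> a \<in> univ B \<and> v (\<phi> a) = u a \<and> v' (\<phi> a) = u' a" for a
    by metis
  have "\<phi> ` univ A \<subseteq> univ B" using \<phi> by blast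
  have "\<phi> (oper A g xs) = oper B g (map \<phi> xs)" if xs: "xs \<in> op_args \<tau> (univ A) g" for g xs
  proof (rule factor_pair_inj[OF fB(1) v v'])
    have ys: "map \<phi> xs \<in> op_args \<tau> (univ B) g"
      using xs \<open>\<phi> ` univ A \<subseteq> univ B\<close> by (rule map_op_args)
    have m: "map (v \<circ> \<phi>) xs = map u xs" "map (v' \<circ> \<phi>) xs = map u' xs"
      using xs \<phi> by (auto simp: op_args_def)
    show "\<phi> (oper A g xs) \<in> univ B" using \<phi> oper_closed[OF A xs] by blast
    show "oper B g (map \<phi> xs) \<in> univ B" using oper_closed[OF B ys] .
    show "v (\<phi> (oper A g xs)) = v (oper B g (map \<phi> xs))"
      using \<phi>[OF oper_closed[OF A xs]] quotient_mapsD(2)[OF v ys] quotient_mapsD(2)[OF u xs] m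
      by simp
    show "v' (\<phi> (oper A g xs)) = v' (oper B g (map \<phi> xs))"
      using \<phi>[OF oper_closed[OF A xs]] quotient_mapsD(2)[OF v' ys] quotient_mapsD(2)[OF u' xs] m
      by simp
  qed
  moreover have "inj_on \<phi> (univ A)"
  proof (rule inj_onI)
    fix a a' assume "a \<in> univ A" "a' \<in> univ A" "\<phi> a = \<phi> a'"
    then show "a = a'" using factor_pair_inj[OF fA(1) u u'] \<phi> by metis
  qed
  moreover have "univ B \<subseteq> \<phi> ` univ A"
  proof
    fix b assume b: "b \<in> univ B"
    then obtain a where a: "a \<in> univ A" "u a = v b" "u' a = v' b"
      using factor_pair_solve[OF fA(1) u u'] quotient_mapsD(4)[OF v] quotient_mapsD(4)[OF v']
      by metis
    then have "\<phi> a = b" using factor_pair_inj[OF fB(1) v v'] \<phi> b by metis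
    then show "b \<in> \<phi> ` univ A" using a by blast
  qed
  ultimately have "\<phi> \<in> alg_iso \<tau> A B"
    using \<open>\<phi> ` univ A \<subseteq> univ B\<close> by (auto simp: alg_iso_def alg_hom_def bij_betw_def)
  then show ?thesis by (auto simp: isomorphic_def)
qed


section \<open>The lattice of congruences and the correspondence theorem\<close>

lemma Delta_Con:
  assumes A: "algebra_of_type \<tau> A"
  shows "Delta A \<in> Con \<tau> A"
proof -
  have "equiv (univ A) (Delta A)"
    by (intro equivI) (auto simp: Delta_def refl_on_def sym_def trans_def)
  moreover have "xs = ys" if "list_all2 (\<lambda>x y. (x, y) \<in> Delta A) xs ys" for xs ys
    using that by (induction rule: list_all2_induct) (auto simp: Delta_def)
  then have "(oper A g xs, oper A g ys) \<in> Delta A"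
    if "xs \<in> op_args \<tau> (univ A) g" "list_all2 (\<lambda>x y. (x, y) \<in> Delta A) xs ys" for g xs ys
    using oper_closed[OF A that(1)] that(2) by (metis Delta_def Id_onI)
  ultimately show ?thesis by (simp add: Con_def)
qed

lemma Nabla_Con:
  assumes A: "algebra_of_type \<tau> A"
  shows "Nabla A \<in> Con \<tau> A"
proof -
  have "equiv (univ A) (Nabla A)"
    by (intro equivI) (auto simp: Nabla_def refl_on_def sym_def trans_def)
  then show ?thesis using oper_closed[OF A] by (simp add: Con_def Nabla_def)
qed

lemma cjoin_upper1: "\<sigma> \<subseteq> cjoin \<tau> A \<sigma> \<theta>"
  and cjoin_upper2: "\<theta> \<subseteq> cjoin \<tau> A \<sigma> \<theta>"
  and cjoin_least: "\<rho> \<in> Con \<tau> A \<Longrightarrow> \<sigma> \<subseteq> \<rho> \<Longrightarrow> \<theta> \<subseteq> \<rho> \<Longrightarrow> cjoin \<tau> A \<sigma> \<theta> \<subseteq> \<rho>"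
  by (auto simp: cjoin_def)

lemma cjoin_commute: "cjoin \<tau> A \<sigma> \<theta> = cjoin \<tau> A \<theta> \<sigma>"
  by (simp add: cjoin_def conj_commute)

lemma cjoin_absorb: "\<theta> \<in> Con \<tau> A \<Longrightarrow> \<sigma> \<subseteq> \<theta> \<Longrightarrow> cjoin \<tau> A \<sigma> \<theta> = \<theta>"
  by (intro equalityI cjoin_least cjoin_upper2 order_refl)

lemma cjoin_Con:
  assumes A: "algebra_of_type \<tau> A" and "\<sigma> \<in> Con \<tau> A" "\<theta> \<in> Con \<tau> A"
  shows "cjoin \<tau> A \<sigma> \<theta> \<in> Con \<tau> A"
proof -
  define S where "S = {\<rho> \<in> Con \<tau> A. \<sigma> \<subseteq> \<rho> \<and> \<theta> \<subseteq> \<rho>}"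
  have S: "\<rho> \<in> Con \<tau> A" if "\<rho> \<in> S" for \<rho> using that by (simp add: S_def)
  have "Nabla A \<in> S"
    using Nabla_Con[OF A] Con_sub[OF assms(2)] Con_sub[OF assms(3)] by (auto simp: S_def Nabla_def)
  then have "\<Inter> S \<subseteq> univ A \<times> univ A" by (auto simp: Nabla_def)
  moreover have "refl_on (univ A) (\<Inter> S)"
    by (intro refl_onI InterI Con_refl[OF S])
  moreover have "sym (\<Inter> S)"
    by (intro symI InterI) (rule Con_sym[OF S], simp_all)
  moreover have "trans (\<Inter> S)"
    by (intro transI InterI) (rule Con_trans[OF S], simp, (erule InterD, assumption)+)
  moreover have "(oper A g xs, oper A g ys) \<in> \<Inter> S"
    if "xs \<in> op_args \<tau> (univ A) g" "ys \<in> op_args \<tau> (univ A) g"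
      and l: "list_all2 (\<lambda>x y. (x, y) \<in> \<Inter> S) xs ys" for g xs ys
  proof
    fix \<rho> assume "\<rho> \<in> S"
    have "list_all2 (\<lambda>x y. (x, y) \<in> \<rho>) xs ys"
      by (rule list_all2_mono[OF l]) (use \<open>\<rho> \<in> S\<close> in blast)
    then show "(oper A g xs, oper A g ys) \<in> \<rho>" by (rule Con_oper[OF S[OF \<open>\<rho> \<in> S\<close>] that(1,2)])
  qed
  ultimately have "\<Inter> S \<in> Con \<tau> A" by (auto simp: Con_def intro: equivI)
  then show ?thesis by (simp add: S_def cjoin_def)
qed

lemma pullback_mono: "\<beta> \<subseteq> \<beta>' \<Longrightarrow> pullback A p \<beta> \<subseteq> pullback A p \<beta>'"
  by (auto simp: pullback_def)

lemma pushforward_mono: "\<alpha> \<subseteq> \<alpha>' \<Longrightarrow> pushforward p \<alpha> \<subseteq> pushforward p \<alpha>'"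
  by (auto simp: pushforward_def)

lemma quot_con_eq_pushforward: "quot_con c \<theta> \<sigma> = pushforward (cls c \<sigma>) \<theta>"
  by (simp add: quot_con_def pushforward_def)

text \<open>The next lemmas make \<open>pushforward p\<close> and \<open>pullback A p\<close> inverse bijections between the
  congruences of \<open>A\<close> above the kernel of \<open>p\<close> and all congruences of the image.\<close>

lemma pushforward_pullback:
  assumes "p \<in> quotient_maps \<tau> A \<alpha> B" "\<beta> \<in> Con \<tau> B"
  shows "pushforward p (pullback A p \<beta>) = \<beta>"
proof
  show "\<beta> \<subseteq> pushforward p (pullback A p \<beta>)"
  proof (rule subrelI)
    fix x y assume xy: "(x, y) \<in> \<beta>"
    then have "x \<in> p ` univ A" "y \<in> p ` univ A"
      using Con_sub[OF assms(2)] quotient_mapsD(1)[OF assms(1)] by auto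
    then obtain a b where "a \<in> univ A" "b \<in> univ A" "x = p a" "y = p b" by blast
    then show "(x, y) \<in> pushforward p (pullback A p \<beta>)"
      using xy by (auto simp: pushforward_def pullback_def)
  qed
qed (auto simp: pushforward_def pullback_def)

lemma pullback_pushforward:
  assumes p: "p \<in> quotient_maps \<tau> A \<alpha> B" and \<theta>: "\<theta> \<in> Con \<tau> A" and "\<alpha> \<subseteq> \<theta>"
  shows "pullback A p (pushforward p \<theta>) = \<theta>"
proof
  show "pullback A p (pushforward p \<theta>) \<subseteq> \<theta>"
  proof clarify
    fix x y assume "(x, y) \<in> pullback A p (pushforward p \<theta>)"
    then obtain a b where "x \<in> univ A" "y \<in> univ A" "(a, b) \<in> \<theta>" "p x = p a" "p b = p y"
      unfolding pullback_def pushforward_def by fastforce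
    moreover from this have "a \<in> univ A" "b \<in> univ A" using Con_sub[OF \<theta>] by auto
    ultimately have "(x, a) \<in> \<theta>" "(b, y) \<in> \<theta>" "(a, b) \<in> \<theta>"
      using quotient_mapsD(3)[OF p] \<open>\<alpha> \<subseteq> \<theta>\<close> by auto
    then show "(x, y) \<in> \<theta>" by (blast intro: Con_trans[OF \<theta>])
  qed
  show "\<theta> \<subseteq> pullback A p (pushforward p \<theta>)"
    using Con_sub[OF \<theta>] by (auto simp: pullback_def pushforward_def)
qed

lemma kernel_sub_pullback:
  assumes "p \<in> quotient_maps \<tau> A \<alpha> B" "\<beta> \<in> Con \<tau> B"
  shows "\<alpha> \<subseteq> pullback A p \<beta>"
proof (rule subrelI)
  fix x y assume "(x, y) \<in> \<alpha>"
  then have "x \<in> univ A" "y \<in> univ A" "p x = p y"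
    using assms(1) by (auto simp: quotient_maps_def pullback_def)
  then show "(x, y) \<in> pullback A p \<beta>"
    using quotient_mapsD(4)[OF assms(1)] Con_refl[OF assms(2)] by (simp add: pullback_def)
qed

lemma pullback_Con:
  assumes A: "algebra_of_type \<tau> A" and p: "p \<in> quotient_maps \<tau> A \<alpha> B" and \<beta>: "\<beta> \<in> Con \<tau> B"
  shows "pullback A p \<beta> \<in> Con \<tau> A"
proof -
  have "equiv (univ A) (pullback A p \<beta>)"
  proof (rule equivI)
    show "pullback A p \<beta> \<subseteq> univ A \<times> univ A" by (auto simp: pullback_def)
    show "refl_on (univ A) (pullback A p \<beta>)"
      using quotient_mapsD(4)[OF p] Con_refl[OF \<beta>] by (simp add: refl_on_def pullback_def)
    show "sym (pullback A p \<beta>)"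
      by (rule symI) (simp add: pullback_def Con_sym[OF \<beta>])
    show "trans (pullback A p \<beta>)"
      by (rule transI) (auto simp: pullback_def intro: Con_trans[OF \<beta>])
  qed
  moreover have "(oper A g xs, oper A g ys) \<in> pullback A p \<beta>"
    if xs: "xs \<in> op_args \<tau> (univ A) g" and ys: "ys \<in> op_args \<tau> (univ A) g"
      and l: "list_all2 (\<lambda>x y. (x, y) \<in> pullback A p \<beta>) xs ys" for g xs ys
  proof -
    have sub: "p ` univ A \<subseteq> univ B" using quotient_mapsD(1)[OF p] by simp
    have "list_all2 (\<lambda>x y. (p x, p y) \<in> \<beta>) xs ys"
      by (rule list_all2_mono[OF l]) (simp add: pullback_def)
    then have "list_all2 (\<lambda>x y. (x, y) \<in> \<beta>) (map p xs) (map p ys)"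
      by (simp add: list_all2_map1 list_all2_map2)
    then have "(oper B g (map p xs), oper B g (map p ys)) \<in> \<beta>"
      by (rule Con_oper[OF \<beta> map_op_args[OF xs sub] map_op_args[OF ys sub]])
    then show ?thesis
      by (simp add: pullback_def oper_closed[OF A] xs ys quotient_mapsD(2)[OF p])
  qed
  ultimately show ?thesis by (simp add: Con_def)
qed

lemma pushforward_Con:
  assumes A: "algebra_of_type \<tau> A" and p: "p \<in> quotient_maps \<tau> A \<alpha> B"
    and \<theta>: "\<theta> \<in> Con \<tau> A" and sub: "\<alpha> \<subseteq> \<theta>"
  shows "pushforward p \<theta> \<in> Con \<tau> B"
proof -
  have B: "univ B = p ` univ A" using quotient_mapsD(1)[OF p] by simp
  have "(p x, p y) \<in> pushforward p \<theta> \<longleftrightarrow> (x, y) \<in> pullback A p (pushforward p \<theta>)"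
    if "x \<in> univ A" "y \<in> univ A" for x y
    using that by (simp add: pullback_def)
  then have iff: "(p x, p y) \<in> pushforward p \<theta> \<longleftrightarrow> (x, y) \<in> \<theta>" if "x \<in> univ A" "y \<in> univ A" for x y
    using that pullback_pushforward[OF p \<theta> sub] by simp
  have ty: "pushforward p \<theta> \<subseteq> univ B \<times> univ B"
    using Con_sub[OF \<theta>] unfolding pushforward_def B by blast
  have "equiv (univ B) (pushforward p \<theta>)"
  proof (rule equivI[OF ty])
    show "refl_on (univ B) (pushforward p \<theta>)"
      by (rule refl_onI) (use iff Con_refl[OF \<theta>] B in force)
    show "sym (pushforward p \<theta>)"
      unfolding sym_def pushforward_def using Con_sym[OF \<theta>] by fast
    show "trans (pushforward p \<theta>)"
    proof (rule transI)
      fix x y z assume xy: "(x, y) \<in> pushforward p \<theta>" and yz: "(y, z) \<in> pushforward p \<theta>"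
      then obtain x' y' z' where mem: "x' \<in> univ A" "y' \<in> univ A" "z' \<in> univ A"
        and eq: "x = p x'" "y = p y'" "z = p z'"
        using ty unfolding B by blast
      have "(x', y') \<in> \<theta>" "(y', z') \<in> \<theta>" using xy yz mem eq iff by simp_all
      then have "(x', z') \<in> \<theta>" by (rule Con_trans[OF \<theta>])
      then show "(x, z) \<in> pushforward p \<theta>" using mem eq iff by simp
    qed
  qed
  moreover have "(oper B g xs, oper B g ys) \<in> pushforward p \<theta>"
    if xs_B: "xs \<in> op_args \<tau> (univ B) g" and ys_B: "ys \<in> op_args \<tau> (univ B) g"
      and l: "list_all2 (\<lambda>x y. (x, y) \<in> pushforward p \<theta>) xs ys" for g xs ys
  proof -
    obtain xs' where xs: "xs' \<in> op_args \<tau> (univ A) g" "map p xs' = xs"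
      using xs_B unfolding B by (rule op_args_lift)
    obtain ys' where ys: "ys' \<in> op_args \<tau> (univ A) g" "map p ys' = ys"
      using ys_B unfolding B by (rule op_args_lift)
    have "list_all2 (\<lambda>x y. (p x, p y) \<in> pushforward p \<theta>) xs' ys'"
      using l unfolding xs(2)[symmetric] ys(2)[symmetric] by (simp add: list_all2_map1 list_all2_map2)
    then have "list_all2 (\<lambda>x y. (x, y) \<in> \<theta>) xs' ys'"
    proof (rule list.rel_mono_strong)
      fix x y assume "x \<in> set xs'" "y \<in> set ys'" "(p x, p y) \<in> pushforward p \<theta>"
      moreover have "set xs' \<subseteq> univ A" "set ys' \<subseteq> univ A" using xs(1) ys(1) by (simp_all add: op_args_def)
      ultimately show "(x, y) \<in> \<theta>" using iff by (metis subsetD)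
    qed
    then have "(oper A g xs', oper A g ys') \<in> \<theta>" by (rule Con_oper[OF \<theta> xs(1) ys(1)])
    then have "(p (oper A g xs'), p (oper A g ys')) \<in> pushforward p \<theta>"
      unfolding pushforward_def by blast
    then show ?thesis using quotient_mapsD(2)[OF p] xs ys by simp
  qed
  ultimately show ?thesis by (simp add: Con_def)
qed

lemma is_quotient_pushforward:
  assumes "algebra_of_type \<tau> A" "p \<in> quotient_maps \<tau> A \<alpha> B" "\<alpha> \<subseteq> \<theta>" "is_quotient \<tau> A \<theta> C"
  shows "is_quotient \<tau> B (pushforward p \<theta>) C"
proof -
  obtain q where "q \<in> quotient_maps \<tau> A \<theta> C" using assms(4) by (auto simp: is_quotient_def)
  then show ?thesis using quotient_map_factor assms(1-3) by blast
qed

lemma is_quotient_pullback: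
  assumes "p \<in> quotient_maps \<tau> A \<alpha> B" "is_quotient \<tau> B \<beta> C"
  shows "is_quotient \<tau> A (pullback A p \<beta>) C"
  using assms quotient_map_comp[OF assms(1)] by (auto simp: is_quotient_def)

lemma Delta_sub: "\<rho> \<in> Con \<tau> A \<Longrightarrow> Delta A \<subseteq> \<rho>"
  by (auto simp: Delta_def Con_refl)

lemma sub_Nabla: "\<rho> \<in> Con \<tau> A \<Longrightarrow> \<rho> \<subseteq> Nabla A"
  using Con_sub by (simp add: Nabla_def)


section \<open>An isomorphism of an algebra with one of its quotients\<close>

locale quotient_isomorphism =
  fixes \<tau> :: "'f signature" and c :: "'u set \<Rightarrow> 'u" and A :: "('f, 'u) alg"
    and \<theta> :: "'u rel" and f :: "'u \<Rightarrow> 'u"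
  assumes alg: "algebra_of_type \<tau> A"
    and \<theta>_Con: "\<theta> \<in> Con \<tau> A"
    and cls_map: "cls c \<theta> \<in> quotient_maps \<tau> A \<theta> (quot \<tau> c A \<theta>)"
    and iso: "f \<in> alg_iso \<tau> A (quot \<tau> c A \<theta>)"
begin

abbreviation F :: "'u rel \<Rightarrow> 'u rel" where "F \<equiv> fhat \<tau> c A \<theta> f"

lemma f_map: "f \<in> quotient_maps \<tau> A (Delta A) (quot \<tau> c A \<theta>)"
  using iso iso_iff_quotient_map by blast

lemma pushforward_f_Con: "\<rho> \<in> Con \<tau> A \<Longrightarrow> pushforward f \<rho> \<in> Con \<tau> (quot \<tau> c A \<theta>)"
  using pushforward_Con[OF alg f_map] Delta_sub by blast

text \<open>By the correspondence theorem for \<open>cls c \<theta>\<close>, \<open>F\<close> is the composition of the bijection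
  induced by \<open>f\<close> with the one from the congruences of \<open>A/\<theta>\<close> to those of \<open>A\<close> above \<open>\<theta>\<close>.\<close>

lemma fhat_eq:
  assumes \<rho>: "\<rho> \<in> Con \<tau> A"
  shows "F \<rho> = pullback A (cls c \<theta>) (pushforward f \<rho>)"
  unfolding fhat_def
proof (rule the_equality)
  note Q = pushforward_f_Con[OF \<rho>]
  show "pullback A (cls c \<theta>) (pushforward f \<rho>) \<in> con_interval \<tau> A \<theta> (Nabla A) \<and>
      quot_con c (pullback A (cls c \<theta>) (pushforward f \<rho>)) \<theta> = pushforward f \<rho>"
    using pullback_Con[OF alg cls_map Q] kernel_sub_pullback[OF cls_map Q]
      pushforward_pullback[OF cls_map Q] sub_Nabla[OF pullback_Con[OF alg cls_map Q]]
    by (auto simp: con_interval_def quot_con_eq_pushforward)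
  fix \<chi> assume "\<chi> \<in> con_interval \<tau> A \<theta> (Nabla A) \<and> quot_con c \<chi> \<theta> = pushforward f \<rho>"
  then show "\<chi> = pullback A (cls c \<theta>) (pushforward f \<rho>)"
    using pullback_pushforward[OF cls_map, of \<chi>]
    by (auto simp: con_interval_def quot_con_eq_pushforward)
qed

lemma fhat_Con: "\<rho> \<in> Con \<tau> A \<Longrightarrow> F \<rho> \<in> Con \<tau> A"
  using fhat_eq pullback_Con[OF alg cls_map pushforward_f_Con] by simp

lemma sub_fhat: "\<rho> \<in> Con \<tau> A \<Longrightarrow> \<theta> \<subseteq> F \<rho>"
  using fhat_eq kernel_sub_pullback[OF cls_map pushforward_f_Con] by simp

lemma quot_con_fhat: "\<rho> \<in> Con \<tau> A \<Longrightarrow> quot_con c (F \<rho>) \<theta> = pushforward f \<rho>"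
  using fhat_eq pushforward_pullback[OF cls_map pushforward_f_Con]
  by (simp add: quot_con_eq_pushforward)

lemma pullback_pushforward_f: "\<rho> \<in> Con \<tau> A \<Longrightarrow> pullback A f (pushforward f \<rho>) = \<rho>"
  using pullback_pushforward[OF f_map] Delta_sub by blast

lemma fhat_sub_iff:
  assumes "\<rho> \<in> Con \<tau> A" "\<rho>' \<in> Con \<tau> A"
  shows "F \<rho> \<subseteq> F \<rho>' \<longleftrightarrow> \<rho> \<subseteq> \<rho>'"
proof
  assume "F \<rho> \<subseteq> F \<rho>'"
  then have "pushforward f \<rho> \<subseteq> pushforward f \<rho>'"
    using pushforward_mono quot_con_fhat assms by (metis quot_con_eq_pushforward)
  then show "\<rho> \<subseteq> \<rho>'"
    using pullback_mono[of "pushforward f \<rho>" "pushforward f \<rho>'" A f] pullback_pushforward_f assms by simp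
next
  assume "\<rho> \<subseteq> \<rho>'"
  then show "F \<rho> \<subseteq> F \<rho>'"
    using fhat_eq assms pullback_mono pushforward_mono by metis
qed

lemma fhat_surj:
  assumes \<chi>: "\<chi> \<in> Con \<tau> A" "\<theta> \<subseteq> \<chi>"
  obtains \<rho> where "\<rho> \<in> Con \<tau> A" "F \<rho> = \<chi>"
proof
  note Q = pushforward_Con[OF alg cls_map \<chi>]
  show Con: "pullback A f (pushforward (cls c \<theta>) \<chi>) \<in> Con \<tau> A"
    by (rule pullback_Con[OF alg f_map Q])
  show "F (pullback A f (pushforward (cls c \<theta>) \<chi>)) = \<chi>"
    using fhat_eq[OF Con] pushforward_pullback[OF f_map Q] pullback_pushforward[OF cls_map \<chi>] by simp
qed

lemma fhat_inv_fhat: "\<rho> \<in> Con \<tau> A \<Longrightarrow> fhat_inv \<tau> c A \<theta> f (F \<rho>) = \<rho>"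
proof -
  assume "\<rho> \<in> Con \<tau> A"
  moreover have "inj_on F (Con \<tau> A)"
    by (rule inj_onI) (use fhat_sub_iff in \<open>simp add: set_eq_subset\<close>)
  ultimately show ?thesis by (simp add: fhat_inv_def)
qed

lemma fhat_Delta: "F (Delta A) = \<theta>"
proof -
  obtain \<rho> where "\<rho> \<in> Con \<tau> A" "F \<rho> = \<theta>" using fhat_surj[OF \<theta>_Con] by blast
  then show ?thesis
    using sub_fhat[OF Delta_Con[OF alg]] fhat_sub_iff[OF Delta_Con[OF alg]] Delta_sub by blast
qed

lemma fhat_Nabla: "F (Nabla A) = Nabla A"
proof -
  have N: "Nabla A \<in> Con \<tau> A" by (rule Nabla_Con[OF alg])
  then obtain \<rho> where "\<rho> \<in> Con \<tau> A" "F \<rho> = Nabla A"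
    using fhat_surj sub_Nabla[OF \<theta>_Con] by blast
  then show ?thesis
    using N fhat_sub_iff sub_Nabla[of \<rho>] sub_Nabla[OF fhat_Con[OF N]] by blast
qed

text \<open>An order isomorphism preserves joins, and joins in the interval above \<open>\<theta>\<close> agree with joins
  in the whole congruence lattice.\<close>

lemma fhat_cjoin:
  assumes \<rho>: "\<rho> \<in> Con \<tau> A" and \<rho>': "\<rho>' \<in> Con \<tau> A"
  shows "F (cjoin \<tau> A \<rho> \<rho>') = cjoin \<tau> A (F \<rho>) (F \<rho>')"
proof
  have J: "cjoin \<tau> A \<rho> \<rho>' \<in> Con \<tau> A" using cjoin_Con[OF alg \<rho> \<rho>'] .
  show "cjoin \<tau> A (F \<rho>) (F \<rho>') \<subseteq> F (cjoin \<tau> A \<rho> \<rho>')"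
    using fhat_sub_iff[OF \<rho> J] fhat_sub_iff[OF \<rho>' J] cjoin_upper1 cjoin_upper2
    by (intro cjoin_least fhat_Con[OF J]) blast+
  have J': "cjoin \<tau> A (F \<rho>) (F \<rho>') \<in> Con \<tau> A"
    using cjoin_Con[OF alg fhat_Con[OF \<rho>] fhat_Con[OF \<rho>']] .
  moreover have "\<theta> \<subseteq> cjoin \<tau> A (F \<rho>) (F \<rho>')" using sub_fhat[OF \<rho>] cjoin_upper1 by blast
  ultimately obtain \<xi> where \<xi>: "\<xi> \<in> Con \<tau> A" "F \<xi> = cjoin \<tau> A (F \<rho>) (F \<rho>')"
    by (rule fhat_surj)
  have "\<rho> \<subseteq> \<xi>" "\<rho>' \<subseteq> \<xi>"
    using fhat_sub_iff[OF \<rho> \<xi>(1)] fhat_sub_iff[OF \<rho>' \<xi>(1)] \<xi>(2) cjoin_upper1 cjoin_upper2 by metis+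
  then have "cjoin \<tau> A \<rho> \<rho>' \<subseteq> \<xi>" using cjoin_least \<xi>(1) by blast
  then show "F (cjoin \<tau> A \<rho> \<rho>') \<subseteq> cjoin \<tau> A (F \<rho>) (F \<rho>')"
    using fhat_sub_iff[OF J \<xi>(1)] \<xi>(2) by simp
qed

text \<open>The isomorphism \<open>f\<close> carries \<open>\<rho>\<close> to the congruence of \<open>A/\<theta>\<close> that corresponds to
  \<open>F \<rho>\<close>; so the quotients of \<open>A\<close> by \<open>\<rho>\<close> and by \<open>F \<rho>\<close> are isomorphic.\<close>

lemma is_quotient_fhat:
  assumes \<rho>: "\<rho> \<in> Con \<tau> A" and C: "is_quotient \<tau> A (F \<rho>) C"
  shows "is_quotient \<tau> A \<rho> C"
  using is_quotient_pullback[OF f_map is_quotient_pushforward[OF alg cls_map sub_fhat[OF \<rho>] C]]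
    quot_con_fhat[OF \<rho>] pullback_pushforward_f[OF \<rho>]
  by (simp add: quot_con_eq_pushforward)

end


section \<open>Completeness and the Cantor-Bernstein-Schroeder property\<close>

locale factor_presheaf =
  fixes \<tau> :: "'f signature" and c :: "'u set \<Rightarrow> 'u" and \<A> :: "('f, 'u) alg set"
    and \<K> :: "('f, 'u) alg \<Rightarrow> 'u rel set"
  assumes category: "category_of_algebras \<tau> \<A>"
    and coding: "class_coding \<tau> c \<A>"
    and presheaf: "factor_congruences_presheaf \<tau> c \<A> \<K>"
begin

lemma operator: "congruences_operator \<tau> c \<A> \<K>"
  using presheaf by (simp add: factor_congruences_presheaf_def congruences_presheaf_def)

lemma obj_algebra: "A \<in> \<A> \<Longrightarrow> algebra_of_type \<tau> A"
  using category by (simp add: category_of_algebras_def)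

lemma K_Con: "A \<in> \<A> \<Longrightarrow> \<sigma> \<in> \<K> A \<Longrightarrow> \<sigma> \<in> Con \<tau> A"
  and Delta_K: "A \<in> \<A> \<Longrightarrow> Delta A \<in> \<K> A"
  and quot_obj: "A \<in> \<A> \<Longrightarrow> \<sigma> \<in> \<K> A \<Longrightarrow> quot \<tau> c A \<sigma> \<in> \<A>"
  using operator unfolding congruences_operator_def by blast+

lemma quot_con_K_iff:
  assumes "A \<in> \<A>" "\<sigma> \<in> \<K> A" "\<theta> \<in> Con \<tau> A" "\<sigma> \<subseteq> \<theta>"
  shows "quot_con c \<theta> \<sigma> \<in> \<K> (quot \<tau> c A \<sigma>) \<longleftrightarrow> \<theta> \<in> \<K> A"
proof -
  have "\<theta> \<in> con_interval \<tau> A \<sigma> (Nabla A)"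
    using assms sub_Nabla[OF assms(3)] by (simp add: con_interval_def)
  then show ?thesis
    using presheaf assms(1,2) by (simp add: factor_congruences_presheaf_def congruences_presheaf_def)
qed

lemma complement_K: "A \<in> \<A> \<Longrightarrow> \<theta> \<in> \<K> A \<Longrightarrow> \<exists>\<theta>' \<in> \<K> A. factor_pair \<tau> A \<theta> \<theta>'"
  using presheaf by (simp add: factor_congruences_presheaf_def)

lemma factor_pair_quot:
  assumes "A \<in> \<A>" "\<sigma> \<in> \<K> A" "\<sigma> \<subseteq> \<theta>" "factor_pair_in \<tau> \<K> A \<theta> \<theta>'"
  shows "factor_pair \<tau> (quot \<tau> c A \<sigma>) (quot_con c \<theta> \<sigma>) (quot_con c (cjoin \<tau> A \<theta>' \<sigma>) \<sigma>)"
proof -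
  have \<theta>: "\<theta> \<in> \<K> A" using assms by (simp add: factor_pair_in_def)
  then have "\<theta> \<in> con_interval \<tau> A \<sigma> (Nabla A)"
    using assms(3) K_Con[OF assms(1) \<theta>] sub_Nabla[OF K_Con[OF assms(1) \<theta>]]
    by (simp add: con_interval_def)
  then have "factor_pair_in \<tau> \<K> (quot \<tau> c A \<sigma>) (quot_con c \<theta> \<sigma>) (quot_con c (cjoin \<tau> A \<theta>' \<sigma>) \<sigma>)"
    using presheaf assms \<theta> by (simp add: factor_congruences_presheaf_def)
  then show ?thesis by (simp add: factor_pair_in_def)
qed

lemma cls_map: "A \<in> \<A> \<Longrightarrow> \<sigma> \<in> \<K> A \<Longrightarrow> cls c \<sigma> \<in> quotient_maps \<tau> A \<sigma> (quot \<tau> c A \<sigma>)"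
  using cls_quotient_map[OF coding] K_Con by blast

lemma is_quotient_quot: "A \<in> \<A> \<Longrightarrow> \<sigma> \<in> \<K> A \<Longrightarrow> is_quotient \<tau> A \<sigma> (quot \<tau> c A \<sigma>)"
  using cls_map by (auto simp: is_quotient_def)

lemma is_quotient_quot_con:
  assumes "A \<in> \<A>" "\<sigma> \<in> \<K> A" "\<sigma> \<subseteq> \<theta>" "is_quotient \<tau> A \<theta> C"
  shows "is_quotient \<tau> (quot \<tau> c A \<sigma>) (quot_con c \<theta> \<sigma>) C"
  using is_quotient_pushforward[OF obj_algebra cls_map] assms
  by (simp add: quot_con_eq_pushforward)

lemma pushforward_K_iff:
  assumes A: "A \<in> \<A>" and B: "B \<in> \<A>" and f: "f \<in> alg_iso \<tau> A B" and \<rho>: "\<rho> \<in> Con \<tau> A"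
  shows "pushforward f \<rho> \<in> \<K> B \<longleftrightarrow> \<rho> \<in> \<K> A"
proof -
  have f': "f \<in> quotient_maps \<tau> A (Delta A) B" using f iso_iff_quotient_map by blast
  have im: "pullback A f ` \<K> B = \<K> A"
    using operator A B f by (auto simp: congruences_operator_def bij_betw_def)
  show ?thesis
  proof
    assume "pushforward f \<rho> \<in> \<K> B"
    then show "\<rho> \<in> \<K> A" using im pullback_pushforward[OF f' \<rho> Delta_sub[OF \<rho>]] by force
  next
    assume "\<rho> \<in> \<K> A"
    then obtain \<beta> where "\<beta> \<in> \<K> B" "\<rho> = pullback A f \<beta>" using im by blast
    then show "pushforward f \<rho> \<in> \<K> B" using pushforward_pullback[OF f' K_Con[OF B]] by simp
  qed
qed

lemma fhat_K_iff:
  assumes A: "A \<in> \<A>" and \<theta>: "\<theta> \<in> \<K> A" and f: "f \<in> alg_iso \<tau> A (quot \<tau> c A \<theta>)"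
    and \<rho>: "\<rho> \<in> Con \<tau> A"
  shows "fhat \<tau> c A \<theta> f \<rho> \<in> \<K> A \<longleftrightarrow> \<rho> \<in> \<K> A"
proof -
  interpret quotient_isomorphism \<tau> c A \<theta> f
    using obj_algebra[OF A] K_Con[OF A \<theta>] cls_map[OF A \<theta>] f by unfold_locales
  show ?thesis
    using quot_con_K_iff[OF A \<theta> fhat_Con[OF \<rho>] sub_fhat[OF \<rho>]] quot_con_fhat[OF \<rho>]
      pushforward_K_iff[OF A quot_obj[OF A \<theta>] f \<rho>] by simp
qed

text \<open>The family below starts at \<open>s 0 = \<zeta>'\<close> and is shifted by one step under \<open>\<rho> \<mapsto> fhat \<rho>\<close>. Hence
  this order isomorphism onto the part of \<open>\<K> A\<close> above \<open>\<theta>\<close> takes the infimum of the whole family,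
  which is \<open>\<zeta>' \<inter> \<iota>\<close>, to the infimum \<open>\<iota>\<close> of its tail. So \<open>\<iota>\<close> is a fixed point of the map
  \<open>\<rho> \<mapsto> fhat (\<zeta>' \<inter> \<rho>)\<close>, as in the proof of the theorem on sets by fixed points.\<close>

lemma fhat_inter_infimum:
  assumes A: "A \<in> \<A>" and \<theta>: "\<theta> \<in> \<K> A" and f: "f \<in> alg_iso \<tau> A (quot \<tau> c A \<theta>)"
    and \<zeta>': "\<zeta>' \<in> Con \<tau> A"
    and s: "\<And>n. s n = cjoin \<tau> A (cbs_sigma \<tau> c A \<theta> f \<zeta> (2 * n)) (cbs_neg \<tau> c A \<theta> f \<zeta>' n)"
    and glb: "isGlb (\<K> A) (s ` {1..}) \<iota>"
    and K: "\<zeta>' \<inter> \<iota> \<in> \<K> A"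
  shows "fhat \<tau> c A \<theta> f (\<zeta>' \<inter> \<iota>) = \<iota>" and "\<theta> \<subseteq> \<iota>"
proof -
  interpret quotient_isomorphism \<tau> c A \<theta> f
    using obj_algebra[OF A] K_Con[OF A \<theta>] cls_map[OF A \<theta>] f by unfold_locales
  have \<iota>: "\<iota> \<in> \<K> A" "\<And>n. \<iota> \<subseteq> s (Suc n)"
    using glb by (auto simp: isGlb_def greatestP_def isLb_def setge_def)
  have greatest: "\<rho> \<subseteq> \<iota>" if "\<rho> \<in> \<K> A" "\<And>n. \<rho> \<subseteq> s (Suc n)" for \<rho>
  proof -
    have "\<rho> \<subseteq> s n" if "n \<ge> 1" for n using \<open>\<And>n. \<rho> \<subseteq> s (Suc n)\<close>[of "n - 1"] that by simp
    then have "isLb (\<K> A) (s ` {1..}) \<rho>" using \<open>\<rho> \<in> \<K> A\<close> by (auto simp: isLb_def setge_def)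
    then show ?thesis using glb by (auto simp: isGlb_def greatestP_def setle_def)
  qed
  have \<sigma>_Con: "cbs_sigma \<tau> c A \<theta> f \<zeta> (2 * n) \<in> Con \<tau> A" for n
    by (induction n) (simp_all add: Delta_Con[OF alg] fhat_Con)
  have neg_Con: "cbs_neg \<tau> c A \<theta> f \<zeta>' n \<in> Con \<tau> A" for n
    by (induction n) (simp_all add: \<zeta>' fhat_Con)
  have s_Con: "s n \<in> Con \<tau> A" for n
    unfolding s by (rule cjoin_Con[OF alg \<sigma>_Con neg_Con])
  have s_0: "s 0 = \<zeta>'" by (simp add: s cjoin_absorb[OF \<zeta>' Delta_sub[OF \<zeta>']])
  have s_Suc: "s (Suc n) = F (s n)" for n
    by (simp add: s fhat_cjoin[OF \<sigma>_Con neg_Con])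
  show "\<theta> \<subseteq> \<iota>" by (rule greatest[OF \<theta>]) (simp add: s_Suc sub_fhat[OF s_Con])
  have lb: "\<zeta>' \<inter> \<iota> \<subseteq> s n" for n
    using \<iota>(2) s_0 by (cases n) auto
  show "F (\<zeta>' \<inter> \<iota>) = \<iota>"
  proof
    show "F (\<zeta>' \<inter> \<iota>) \<subseteq> \<iota>"
      using fhat_K_iff[OF A \<theta> f K_Con[OF A K]] K fhat_sub_iff[OF K_Con[OF A K] s_Con] lb
      by (intro greatest) (simp_all add: s_Suc)
    obtain \<rho> where \<rho>: "\<rho> \<in> Con \<tau> A" "F \<rho> = \<iota>"
      using fhat_surj[OF K_Con[OF A \<iota>(1)] \<open>\<theta> \<subseteq> \<iota>\<close>] .
    have \<rho>_s: "\<rho> \<subseteq> s n" for n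
      using \<iota>(2)[of n] \<rho>(2) fhat_sub_iff[OF \<rho>(1) s_Con] by (simp add: s_Suc)
    have "\<rho> \<in> \<K> A" using fhat_K_iff[OF A \<theta> f \<rho>(1)] \<rho>(2) \<iota>(1) by simp
    then have "\<rho> \<subseteq> \<iota>" using greatest \<rho>_s by blast
    moreover have "\<rho> \<subseteq> \<zeta>'" using \<rho>_s s_0 by metis
    ultimately show "\<iota> \<subseteq> F (\<zeta>' \<inter> \<iota>)"
      using fhat_sub_iff[OF \<rho>(1) K_Con[OF A K]] \<rho>(2) by simp
  qed
qed

text \<open>The common factors of \<open>A\<close> and \<open>A/\<zeta>\<close> are the quotients of \<open>A\<close> by \<open>\<iota>\<close> and by the join of
  \<open>\<zeta>\<close> and \<open>\<iota>'\<close>. Both congruences contain \<open>\<zeta>\<close>, so \<open>A/\<zeta>\<close> has these quotients too, and up to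
  isomorphism the first one is also the quotient of \<open>A\<close> by \<open>\<zeta>' \<inter> \<iota>\<close>.\<close>

lemma complete_imp_quot_isomorphic:
  assumes A: "A \<in> \<A>" and complete: "CBS_complete \<tau> c \<K> A"
    and \<theta>: "\<theta> \<in> \<K> A" and \<sigma>: "\<sigma> \<in> \<K> A" "\<sigma> \<subseteq> \<theta>" and iso: "isomorphic \<tau> A (quot \<tau> c A \<theta>)"
  shows "isomorphic \<tau> A (quot \<tau> c A \<sigma>)"
proof -
  obtain f where f: "f \<in> alg_iso \<tau> A (quot \<tau> c A \<theta>)" using iso by (auto simp: isomorphic_def)
  interpret quotient_isomorphism \<tau> c A \<theta> f
    using obj_algebra[OF A] K_Con[OF A \<theta>] cls_map[OF A \<theta>] f by unfold_locales
  from complete[unfolded CBS_complete_def, rule_format, OF \<theta> f \<sigma>] obtain \<zeta> \<zeta>' s \<iota> \<iota>' where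
    \<zeta>_class: "\<zeta> \<in> iso_class \<tau> c \<K> A \<theta> \<sigma>" and seq: "CBS_sequence \<tau> c \<K> A \<theta> f \<zeta> \<zeta>' s"
    and glb: "isGlb (\<K> A) (s ` {1..}) \<iota>"
    and pair: "factor_pair_in \<tau> \<K> A \<iota> \<iota>'"
    and pair': "factor_pair_in \<tau> \<K> A (\<zeta>' \<inter> \<iota>) (cjoin \<tau> A \<zeta> \<iota>')"
    by (elim bexE exE conjE)
  have \<zeta>: "\<zeta> \<in> \<K> A" "\<zeta> \<subseteq> \<theta>" "isomorphic \<tau> (quot \<tau> c A \<sigma>) (quot \<tau> c A \<zeta>)"
    using \<zeta>_class by (auto simp: iso_class_def)
  have \<zeta>': "\<zeta>' \<in> Con \<tau> A"
  proof -
    obtain \<nu> where \<nu>: "\<nu> \<in> \<K> A" "\<zeta>' = fhat_inv \<tau> c A \<theta> f (cjoin \<tau> A \<theta> \<nu>)"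
      using seq by (auto simp: CBS_sequence_def)
    obtain \<rho> where "\<rho> \<in> Con \<tau> A" "F \<rho> = cjoin \<tau> A \<theta> \<nu>"
      using fhat_surj[OF cjoin_Con[OF alg \<theta>_Con K_Con[OF A \<nu>(1)]] cjoin_upper1] .
    then show ?thesis using fhat_inv_fhat \<nu>(2) by metis
  qed
  have K: "\<zeta>' \<inter> \<iota> \<in> \<K> A" "cjoin \<tau> A \<zeta> \<iota>' \<in> \<K> A" "\<iota> \<in> \<K> A"
    using pair pair' by (auto simp: factor_pair_in_def)
  have s: "s n = cjoin \<tau> A (cbs_sigma \<tau> c A \<theta> f \<zeta> (2 * n)) (cbs_neg \<tau> c A \<theta> f \<zeta>' n)" for n
    using seq by (simp add: CBS_sequence_def)
  note fix_inf = fhat_inter_infimum[OF A \<theta> f \<zeta>' s glb K(1)]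
  let ?C = "quot \<tau> c A \<iota>" and ?D = "quot \<tau> c A (cjoin \<tau> A \<zeta> \<iota>')"
  have C: "is_quotient \<tau> A \<iota> ?C" and D: "is_quotient \<tau> A (cjoin \<tau> A \<zeta> \<iota>') ?D"
    using is_quotient_quot[OF A] K by blast+
  have A_C: "is_quotient \<tau> A (\<zeta>' \<inter> \<iota>) ?C"
    by (rule is_quotient_fhat[OF K_Con[OF A K(1)]]) (simp add: C fix_inf(1))
  have sub: "\<zeta> \<subseteq> \<iota>" using \<zeta>(2) fix_inf(2) by (rule subset_trans)
  have pair_A: "factor_pair \<tau> A (\<zeta>' \<inter> \<iota>) (cjoin \<tau> A \<zeta> \<iota>')"
    using pair' by (simp add: factor_pair_in_def)
  have pair_Q: "factor_pair \<tau> (quot \<tau> c A \<zeta>) (quot_con c \<iota> \<zeta>) (quot_con c (cjoin \<tau> A \<zeta> \<iota>') \<zeta>)"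
    using factor_pair_quot[OF A \<zeta>(1) sub pair] unfolding cjoin_commute[of \<tau> A \<iota>' \<zeta>] .
  have "isomorphic \<tau> A (quot \<tau> c A \<zeta>)"
    by (rule isomorphic_if_same_factors[OF alg obj_algebra[OF quot_obj[OF A \<zeta>(1)]]
          pair_A A_C D pair_Q is_quotient_quot_con[OF A \<zeta>(1) sub C]
          is_quotient_quot_con[OF A \<zeta>(1) cjoin_upper1 D]])
  then show ?thesis
    by (rule isomorphic_trans[OF _ isomorphic_sym[OF obj_algebra[OF quot_obj[OF A \<sigma>(1)]] \<zeta>(3)]])
qed

text \<open>Pulling \<open>\<theta>B\<close> back along \<open>A \<rightarrow> A/\<theta>A \<cong> B\<close> gives a congruence \<open>\<theta>\<close> above \<open>\<theta>A\<close> with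
  \<open>A/\<theta> \<cong> B/\<theta>B \<cong> A\<close>.\<close>

lemma complete_imp_CBS:
  assumes A: "A \<in> \<A>" and complete: "CBS_complete \<tau> c \<K> A"
  shows "CBS_property \<tau> c \<A> \<K> A"
  unfolding CBS_property_def
proof (intro ballI impI, elim conjE)
  fix B \<theta>B \<theta>A
  assume B: "B \<in> \<A>" "\<theta>B \<in> \<K> B" and \<theta>A: "\<theta>A \<in> \<K> A"
    and AB: "isomorphic \<tau> A (quot \<tau> c B \<theta>B)" and BA: "isomorphic \<tau> B (quot \<tau> c A \<theta>A)"
  note alg = obj_algebra[OF A]
  note QA = quot_obj[OF A \<theta>A]
  obtain h where h: "h \<in> alg_iso \<tau> B (quot \<tau> c A \<theta>A)" using BA by (auto simp: isomorphic_def)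
  then have h': "h \<in> quotient_maps \<tau> B (Delta B) (quot \<tau> c A \<theta>A)"
    using iso_iff_quotient_map by blast
  let ?\<beta> = "pushforward h \<theta>B"
  define \<theta> where "\<theta> = pullback A (cls c \<theta>A) ?\<beta>"
  have \<beta>: "?\<beta> \<in> \<K> (quot \<tau> c A \<theta>A)"
    using pushforward_K_iff[OF B(1) QA h K_Con[OF B]] B(2) by simp
  note \<beta>_Con = K_Con[OF QA \<beta>]
  have \<theta>_Con: "\<theta> \<in> Con \<tau> A" and sub: "\<theta>A \<subseteq> \<theta>"
    unfolding \<theta>_def
    using pullback_Con[OF alg cls_map[OF A \<theta>A] \<beta>_Con] kernel_sub_pullback[OF cls_map[OF A \<theta>A] \<beta>_Con]
    by auto
  have \<theta>: "\<theta> \<in> \<K> A"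
    using quot_con_K_iff[OF A \<theta>A \<theta>_Con sub] pushforward_pullback[OF cls_map[OF A \<theta>A] \<beta>_Con] \<beta>
    by (simp add: quot_con_eq_pushforward \<theta>_def)
  have "is_quotient \<tau> B \<theta>B A"
    using is_quotient_isomorphic[OF is_quotient_quot[OF B]] isomorphic_sym[OF alg AB] by blast
  then have "is_quotient \<tau> (quot \<tau> c A \<theta>A) ?\<beta> A"
    using is_quotient_pushforward[OF obj_algebra[OF B(1)] h' Delta_sub[OF K_Con[OF B]]] by blast
  then have "is_quotient \<tau> A \<theta> A"
    unfolding \<theta>_def by (rule is_quotient_pullback[OF cls_map[OF A \<theta>A]])
  then have "isomorphic \<tau> A (quot \<tau> c A \<theta>)"
    using is_quotient_unique[OF alg] is_quotient_quot[OF A \<theta>] by blast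
  then have "isomorphic \<tau> A (quot \<tau> c A \<theta>A)"
    by (rule complete_imp_quot_isomorphic[OF A complete \<theta> \<theta>A sub])
  then show "isomorphic \<tau> A B"
    by (rule isomorphic_trans[OF _ isomorphic_sym[OF obj_algebra[OF B(1)] BA]])
qed

text \<open>Put \<open>B = A/\<sigma>\<close>: then \<open>A\<close>, being isomorphic to \<open>A/\<theta>\<close>, is a quotient of \<open>B\<close>, and the property
  makes \<open>A\<close> isomorphic to \<open>A/\<sigma>\<close>. So \<open>\<zeta>\<close> can be the least congruence, and the CBS-sequence is then
  constant with value \<open>Nabla A\<close>.\<close>

lemma CBS_imp_complete:
  assumes A: "A \<in> \<A>" and CBS: "CBS_property \<tau> c \<A> \<K> A"
  shows "CBS_complete \<tau> c \<K> A"
  unfolding CBS_complete_def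
proof (intro ballI impI)
  fix \<theta> f \<sigma>
  assume \<theta>: "\<theta> \<in> \<K> A" and f: "f \<in> alg_iso \<tau> A (quot \<tau> c A \<theta>)" and \<sigma>: "\<sigma> \<in> \<K> A" "\<sigma> \<subseteq> \<theta>"
  interpret quotient_isomorphism \<tau> c A \<theta> f
    using obj_algebra[OF A] K_Con[OF A \<theta>] cls_map[OF A \<theta>] f by unfold_locales
  let ?B = "quot \<tau> c A \<sigma>"
  note B = quot_obj[OF A \<sigma>(1)]
  have \<theta>\<sigma>: "quot_con c \<theta> \<sigma> \<in> \<K> ?B" using quot_con_K_iff[OF A \<sigma>(1) \<theta>_Con \<sigma>(2)] \<theta> by simp
  have "isomorphic \<tau> A (quot \<tau> c A \<theta>)" using f by (auto simp: isomorphic_def)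
  then have "is_quotient \<tau> A \<theta> A"
    using is_quotient_isomorphic[OF is_quotient_quot[OF A \<theta>]] isomorphic_sym[OF alg] by blast
  then have "isomorphic \<tau> A (quot \<tau> c ?B (quot_con c \<theta> \<sigma>))"
    by (rule is_quotient_unique[OF obj_algebra[OF B] is_quotient_quot_con[OF A \<sigma>]
          is_quotient_quot[OF B \<theta>\<sigma>]])
  then have AB: "isomorphic \<tau> A ?B"
    using CBS[unfolded CBS_property_def, rule_format, OF B \<theta>\<sigma> \<sigma>(1)] isomorphic_refl[of \<tau> ?B]
    by simp
  have "isomorphic \<tau> ?B (quot \<tau> c A (Delta A))"
    using is_quotient_unique[OF alg _ is_quotient_quot[OF A Delta_K[OF A]]] AB
    by (simp add: isomorphic_iff)
  then have \<zeta>: "Delta A \<in> iso_class \<tau> c \<K> A \<theta> \<sigma>"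
    using Delta_K[OF A] Delta_sub[OF \<theta>_Con] by (simp add: iso_class_def)
  have N: "Nabla A \<in> Con \<tau> A" by (rule Nabla_Con[OF alg])
  obtain \<nu> where \<nu>: "\<nu> \<in> \<K> A" "factor_pair \<tau> A \<theta> \<nu>" using complement_K[OF A \<theta>] by blast
  have "\<theta> O \<nu> \<subseteq> cjoin \<tau> A \<theta> \<nu>"
  proof clarify
    fix x y z assume "(x, y) \<in> \<theta>" "(y, z) \<in> \<nu>"
    then show "(x, z) \<in> cjoin \<tau> A \<theta> \<nu>"
      by (rule Con_trans[OF cjoin_Con[OF alg \<theta>_Con K_Con[OF A \<nu>(1)]]
            subsetD[OF cjoin_upper1] subsetD[OF cjoin_upper2]])
  qed
  then have "cjoin \<tau> A \<theta> \<nu> = Nabla A"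
    using \<nu>(2) sub_Nabla[OF cjoin_Con[OF alg \<theta>_Con K_Con[OF A \<nu>(1)]]]
    by (simp add: factor_pair_def subset_antisym)
  then have inv: "fhat_inv \<tau> c A \<theta> f (cjoin \<tau> A \<theta> \<nu>) = Nabla A"
    using fhat_inv_fhat[OF N] fhat_Nabla by simp
  let ?s = "\<lambda>n :: nat. Nabla A"
  have "cbs_neg \<tau> c A \<theta> f (Nabla A) n = Nabla A" for n
    by (induction n) (simp_all add: fhat_Nabla)
  moreover have "cbs_sigma \<tau> c A \<theta> f (Delta A) (2 * n) \<in> Con \<tau> A" for n
    by (induction n) (simp_all add: Delta_Con[OF alg] fhat_Con)
  ultimately have seq: "CBS_sequence \<tau> c \<K> A \<theta> f (Delta A) (Nabla A) ?s"
    unfolding CBS_sequence_def factor_pair_in_def fhat_Delta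
    by (intro conjI allI bexI[OF _ \<nu>(1)] \<nu> \<theta> inv[symmetric])
      (simp add: cjoin_absorb[OF N sub_Nabla[of _ \<tau>]])
  \<comment> \<open>The complement of the least congruence is the greatest one, which is thus in \<open>\<K> A\<close>.\<close>
  obtain \<kappa> where \<kappa>: "\<kappa> \<in> \<K> A" "factor_pair \<tau> A (Delta A) \<kappa>"
    using complement_K[OF A Delta_K[OF A]] by blast
  have "Delta A O \<kappa> \<subseteq> \<kappa>" by (auto simp: Delta_def)
  then have "\<kappa> = Nabla A" using \<kappa>(2) sub_Nabla[OF K_Con[OF A \<kappa>(1)]] by (auto simp: factor_pair_def)
  then have NK: "Nabla A \<in> \<K> A" using \<kappa>(1) by simp
  have "Nabla A \<inter> Delta A = Delta A" "Nabla A O Delta A = Nabla A"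
    by (auto simp: Nabla_def Delta_def)
  then have pair: "factor_pair_in \<tau> \<K> A (Nabla A) (Delta A)"
    using NK Delta_K[OF A] N Delta_Con[OF alg] by (simp add: factor_pair_in_def factor_pair_def)
  have glb: "isGlb (\<K> A) (?s ` {1..}) (Nabla A)"
    using NK by (auto simp: isGlb_def greatestP_def isLb_def setge_def setle_def)
  have "factor_pair_in \<tau> \<K> A (Nabla A \<inter> Nabla A) (cjoin \<tau> A (Delta A) (Delta A))"
    using pair cjoin_absorb[OF Delta_Con[OF alg] order_refl] by simp
  then show "\<exists>\<zeta>\<in>iso_class \<tau> c \<K> A \<theta> \<sigma>. \<exists>\<zeta>' s. CBS_sequence \<tau> c \<K> A \<theta> f \<zeta> \<zeta>' s \<and>
      (\<exists>\<sigma>\<zeta>. isGlb (\<K> A) (s ` {1..}) \<sigma>\<zeta> \<and>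
        (\<exists>\<sigma>\<zeta>'\<in>\<K> A. factor_pair_in \<tau> \<K> A \<sigma>\<zeta> \<sigma>\<zeta>' \<and>
           factor_pair_in \<tau> \<K> A (\<zeta>' \<inter> \<sigma>\<zeta>) (cjoin \<tau> A \<zeta> \<sigma>\<zeta>')))"
    by (intro bexI[OF _ \<zeta>] exI[of _ "Nabla A"] exI[of _ ?s] bexI[OF _ Delta_K[OF A]] conjI seq glb pair)
qed

end

theorem theorem3p9:
  fixes \<tau> :: "'f signature"
    and c :: "'u set \<Rightarrow> 'u"
    and \<A> :: "('f, 'u) alg set"
    and \<K> :: "('f, 'u) alg \<Rightarrow> 'u rel set"
    and A :: "('f, 'u) alg"
  assumes "category_of_algebras \<tau> \<A>"
    and "class_coding \<tau> c \<A>"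
    and "factor_congruences_presheaf \<tau> c \<A> \<K>"
    and "A \<in> \<A>"
  shows "CBS_complete \<tau> c \<K> A \<longleftrightarrow> CBS_property \<tau> c \<A> \<K> A"
proof -
  interpret factor_presheaf \<tau> c \<A> \<K> using assms(1-3) by unfold_locales
  show ?thesis using complete_imp_CBS CBS_imp_complete \<open>A \<in> \<A>\<close> by blast
qed

end
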